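(* A generic equation of degree $7$ can be solved by 2-fold origami. That is: there is a nonzero polynomial $D\in\mathbb{Q}[c_0,\dots,c_7]$ such that for all real numbers $c_0,\dots,c_7$ with $c_7\neq 0$ and $D(c_0,\dots,c_7)\neq 0$, every real root of the polynomial $$c_7W^7+c_6W^6+c_5W^5+c_4W^4+c_3W^3+c_2W^2+c_1W+c_0$$ is constructible by 2-fold origami from $c_0,\dots,c_7$. (In particular this applies to rational coefficients, in which case the roots are constructible by 2-fold origami from the empty set of data.)
   Context: For a line $l\subset\mathbb{R}^2$, write $P^l$ and $L^l$ for the image of a point $P$, resp. a line $L$, under reflection across $l$ (the "folded point" and "folded line"). 2-fold origami. Given a set $E\subset\mathbb{R}$ of data, one starts with the points $(0,0),(1,0),(0,1)$ and $(s,0)$ for $s\in E$, and successively constructs points and lines by the following operations. (i) The intersection point of two distinct non-parallel constructed lines is constructed; the images $P^l$, $L^l$ of constructed points $P$ and lines $L$ under reflection across a constructed line $l$ are constructed. (ii) (1-fold step) A line $l$ is constructed if it satisfies a finite set of alignments that is satisfied by only finitely many lines, where an alignment is a condition that two points coincide, a point lies on a line, or two lines coincide, among the objects: constructed points $P$, constructed lines $L$, the fold line $l$, and the folded objects $P^l$, $L^l$. (iii) (2-fold step) Two lines $l_a,l_b$ are simultaneously constructed if the pair $(l_a,l_b)$ satisfies a finite set of alignments that is satisfied by only finitely many pairs of lines, where alignments are now conditions of the same three types among the objects: constructed points $P$, constructed lines $L$, the fold lines $l_a,l_b$, and the folded objects $P^{l_a},P^{l_b},L^{l_a},L^{l_b},l_a^{l_b},l_b^{l_a}$.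 An example of a 2-fold step is the axiom AL6ab8: given constructed points $P,Q,R,S$ and lines $m,n$, construct $l_1,l_2$ with $P^{l_1}\in m$, $R^{l_2}\in n$ and $Q^{l_1}=S^{l_2}$ (whenever there are only finitely many such pairs). A real number $r$ is constructible by 2-fold origami from $E$ if the point $(r,0)$ can be constructed in finitely many such steps from $E$. *)

theory Defs
  imports "HOL-Analysis.Analysis" "HOL-Library.Poly_Mapping"
begin

section \<open>Points, lines and reflections in the plane\<close>

type_synonym point = "real \<times> real"
type_synonym line = "point set"

definition is_line :: "line \<Rightarrow> bool" where
  "is_line l \<longleftrightarrow> (\<exists>P Q. P \<noteq> Q \<and> l = affine hull {P, Q})"

text \<open>For a line \<open>l\<close>, the closest point on \<open>l\<close> is the foot of the perpendicular from \<open>P\<close>, and it is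
  the midpoint of \<open>P\<close> and its mirror image. The folded line is the image
  \<open>line_reflection l ` L\<close>.\<close>

definition line_reflection :: "line \<Rightarrow> point \<Rightarrow> point" where
  "line_reflection l P = 2 *\<^sub>R closest_point l P - P"


section \<open>Alignments\<close>

text \<open>An alignment is syntax: a relation between two terms, which name given objects, the unknown
  fold lines, or folded objects. The set functions of the datatypes (\<open>point_terms\<close>,
  \<open>line_terms\<close>, \<open>given_point1\<close>, \dots) collect the objects occurring in them.\<close>

datatype (point_terms: 'p, line_terms: 'l) alignment =
    Points_Coincide 'p 'p
  | Point_On_Line 'p 'l
  | Lines_Coincide 'l 'l

primrec holds :: "('p \<Rightarrow> point) \<Rightarrow> ('l \<Rightarrow> line) \<Rightarrow> ('p, 'l) alignment \<Rightarrow> bool" where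
  "holds ip il (Points_Coincide p q) \<longleftrightarrow> ip p = ip q"
| "holds ip il (Point_On_Line p k) \<longleftrightarrow> ip p \<in> il k"
| "holds ip il (Lines_Coincide k m) \<longleftrightarrow> il k = il m"

subsection \<open>One fold line\<close>

datatype (given_point1: 'p) point_term1 =
    Point1 'p
  | Folded_Point1 'p

datatype (given_line1: 'l) line_term1 =
    Line1 'l
  | Fold1
  | Folded_Line1 'l

primrec point_val1 :: "line \<Rightarrow> point point_term1 \<Rightarrow> point" where
  "point_val1 l (Point1 P) = P"
| "point_val1 l (Folded_Point1 P) = line_reflection l P"

primrec line_val1 :: "line \<Rightarrow> line line_term1 \<Rightarrow> line" where
  "line_val1 l (Line1 L) = L"
| "line_val1 l Fold1 = l"
| "line_val1 l (Folded_Line1 L) = line_reflection l ` L"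

type_synonym alignment1 = "(point point_term1, line line_term1) alignment"

definition solutions1 :: "alignment1 set \<Rightarrow> line set" where
  "solutions1 A = {l. is_line l \<and> (\<forall>a\<in>A. holds (point_val1 l) (line_val1 l) a)}"

definition given_points1 :: "alignment1 set \<Rightarrow> point set" where
  "given_points1 A = (\<Union>a\<in>A. \<Union>p\<in>point_terms a. given_point1 p)"

definition given_lines1 :: "alignment1 set \<Rightarrow> line set" where
  "given_lines1 A = (\<Union>a\<in>A. \<Union>k\<in>line_terms a. given_line1 k)"

subsection \<open>Two simultaneous fold lines\<close>

datatype (given_point2: 'p) point_term2 =
    Point2 'p
  | Folded_Point_a 'p
  | Folded_Point_b 'p

datatype (given_line2: 'l) line_term2 =
    Line2 'l
  | Fold_a
  | Fold_b
  | Folded_Line_a 'l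
  | Folded_Line_b 'l
  | Fold_a_Folded_b  \<comment> \<open>the image of the first fold line under the second fold\<close>
  | Fold_b_Folded_a

primrec point_val2 :: "line \<Rightarrow> line \<Rightarrow> point point_term2 \<Rightarrow> point" where
  "point_val2 la lb (Point2 P) = P"
| "point_val2 la lb (Folded_Point_a P) = line_reflection la P"
| "point_val2 la lb (Folded_Point_b P) = line_reflection lb P"

primrec line_val2 :: "line \<Rightarrow> line \<Rightarrow> line line_term2 \<Rightarrow> line" where
  "line_val2 la lb (Line2 L) = L"
| "line_val2 la lb Fold_a = la"
| "line_val2 la lb Fold_b = lb"
| "line_val2 la lb (Folded_Line_a L) = line_reflection la ` L"
| "line_val2 la lb (Folded_Line_b L) = line_reflection lb ` L"
| "line_val2 la lb Fold_a_Folded_b = line_reflection lb ` la"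
| "line_val2 la lb Fold_b_Folded_a = line_reflection la ` lb"

type_synonym alignment2 = "(point point_term2, line line_term2) alignment"

definition solutions2 :: "alignment2 set \<Rightarrow> (line \<times> line) set" where
  "solutions2 A = {(la, lb). is_line la \<and> is_line lb \<and>
     (\<forall>a\<in>A. holds (point_val2 la lb) (line_val2 la lb) a)}"

definition given_points2 :: "alignment2 set \<Rightarrow> point set" where
  "given_points2 A = (\<Union>a\<in>A. \<Union>p\<in>point_terms a. given_point2 p)"

definition given_lines2 :: "alignment2 set \<Rightarrow> line set" where
  "given_lines2 A = (\<Union>a\<in>A. \<Union>k\<in>line_terms a. given_line2 k)"


section \<open>Constructible points and lines\<close>

text \<open>A shared point is unique exactly when two lines are distinct and not parallel, so
  \<open>l \<inter> m = {P}\<close> says that \<open>P\<close> is the intersection point of such lines.\<close>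

inductive origami_point :: "real set \<Rightarrow> point \<Rightarrow> bool"
  and origami_line :: "real set \<Rightarrow> line \<Rightarrow> bool"
  for E :: "real set"
where
  origin: "origami_point E (0, 0)"
| unit_x: "origami_point E (1, 0)"
| unit_y: "origami_point E (0, 1)"
| datum: "s \<in> E \<Longrightarrow> origami_point E (s, 0)"
| intersection: "origami_line E l \<Longrightarrow> origami_line E m \<Longrightarrow> l \<inter> m = {P} \<Longrightarrow> origami_point E P"
| folded_point: "origami_point E P \<Longrightarrow> origami_line E l \<Longrightarrow> origami_point E (line_reflection l P)"
| folded_line: "origami_line E L \<Longrightarrow> origami_line E l \<Longrightarrow> origami_line E (line_reflection l ` L)"
| one_fold:
    "finite A \<Longrightarrow> \<forall>P\<in>given_points1 A. origami_point E P \<Longrightarrow> \<forall>L\<in>given_lines1 A. origami_line E L \<Longrightarrow>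
     finite (solutions1 A) \<Longrightarrow> l \<in> solutions1 A \<Longrightarrow> origami_line E l"
| two_fold_a:
    "finite A \<Longrightarrow> \<forall>P\<in>given_points2 A. origami_point E P \<Longrightarrow> \<forall>L\<in>given_lines2 A. origami_line E L \<Longrightarrow>
     finite (solutions2 A) \<Longrightarrow> (la, lb) \<in> solutions2 A \<Longrightarrow> origami_line E la"
| two_fold_b:
    "finite A \<Longrightarrow> \<forall>P\<in>given_points2 A. origami_point E P \<Longrightarrow> \<forall>L\<in>given_lines2 A. origami_line E L \<Longrightarrow>
     finite (solutions2 A) \<Longrightarrow> (la, lb) \<in> solutions2 A \<Longrightarrow> origami_line E lb"

definition two_fold_constructible :: "real set \<Rightarrow> real \<Rightarrow> bool" where
  "two_fold_constructible E r \<longleftrightarrow> origami_point E (r, 0)"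


section \<open>Multivariate polynomials\<close>

text \<open>A finitely supported map from exponent vectors to coefficients is a polynomial in the
  variables indexed by \<open>nat\<close>; its variables are the indices in the supports of its exponent
  vectors.\<close>

type_synonym rat_mpoly = "(nat \<Rightarrow>\<^sub>0 nat) \<Rightarrow>\<^sub>0 rat"

definition mpoly_vars :: "rat_mpoly \<Rightarrow> nat set" where
  "mpoly_vars D = (\<Union>m\<in>Poly_Mapping.keys D. Poly_Mapping.keys m)"

definition mpoly_eval :: "rat_mpoly \<Rightarrow> (nat \<Rightarrow> real) \<Rightarrow> real" where
  "mpoly_eval D c = (\<Sum>m\<in>Poly_Mapping.keys D. of_rat (Poly_Mapping.lookup D m) *
     (\<Prod>i\<in>Poly_Mapping.keys m. c i ^ Poly_Mapping.lookup m i))"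

end

theory Submission
  imports Defs
begin

text \<open>
  A fold that takes a point \<open>P\<close> onto a line \<open>m\<close> not through \<open>P\<close> is a tangent of the parabola with focus \<open>P\<close> and directrix
  \<open>m\<close>. While the fold line runs through these tangents, the image of a second point \<open>Q\<close> traces out a cubic that passes
  through the two circular points at infinity, has a double point at \<open>Q\<close>, and is parametrized rationally by
  the slope \<open>t\<close> of the fold. The axiom AL6ab8 intersects two such cubics. Of their nine intersections two are the
  circular points, and the parameters \<open>t\<close> of the other seven are the roots of a septic. It remains to choose the
  two parabolas and the two points so that a given septic arises, with parameters that are real and already
  constructible.

  The points \<open>Q\<close> and \<open>S\<close> are placed on a common parallel of the first directrix, at distance \<open>d\<close>. The given septic
  \<open>F\<close> is expanded in powers of \<open>q = t\<^sup>2 + e\<close> with linear digits \<open>a\<^sub>i * t + b\<^sub>i\<close>. The expansions that occur have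
  \<open>a\<^sub>0 = 0\<close>, which is a cubic equation for \<open>e\<close>; all other digits can be matched by the data of the second
  parabola as soon as \<open>d\<close> and one more number \<open>\<rho>\<close> satisfy two equations (\<open>septic_identity\<close>,
  \<open>circular_cubic_as_fold_locus\<close>). Eliminating \<open>\<rho>\<close> leaves a quartic for \<open>d\<close>. So the parameters are found by
  solving equations of degree at most four, and single folds suffice for that: the real numbers obtained by origami form a
  field that contains all real roots of cubics over it (\<open>cubic_root_constructible\<close>), and therefore also square roots and the
  real roots of quartics (\<open>quartic_root_constructible\<close>).

  The parameters are real if the quartic has a real zero \<open>d\<close> with \<open>\<rho> + e > 0\<close>. This follows from a few sign
  conditions on the digits (\<open>septic_root_constructible_of_signs\<close>). They hold for the septic \<open>(1 + t) ^ 7\<close>,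
  and they are open conditions. The substitution \<open>W = (1 + t) / \<epsilon>\<close> with a small rational number \<open>\<epsilon> > 0\<close> brings
  every septic, up to a constant factor, close to \<open>(1 + t) ^ 7\<close>, and \<open>W\<close> is constructible together with \<open>t\<close>
  (\<open>septic_root_constructible\<close>). As this covers every septic, the constant \<open>1\<close> serves as the polynomial \<open>D\<close>.
\<close>


section \<open>Lines and reflections in coordinates\<close>

definition coord_line :: "real \<Rightarrow> real \<Rightarrow> real \<Rightarrow> line" where
  "coord_line a b c = {(x, y). a * x + b * y = c}"

lemma mem_coord_line [simp]: "(x, y) \<in> coord_line a b c \<longleftrightarrow> a * x + b * y = c"
  by (simp add: coord_line_def)

lemma coord_line_conv_inner: "coord_line a b c = {p. inner (a, b) p = c}"
  by (auto simp: coord_line_def)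

lemma normal_pos: "a \<noteq> 0 \<or> b \<noteq> 0 \<Longrightarrow> 0 < a\<^sup>2 + (b::real)\<^sup>2"
  by (simp only: sum_power2_gt_zero_iff)

text \<open>Lines are compared through a common point: parallel normals and one shared point suffice, which
  avoids solving for the factor between the two equations.\<close>

lemma coord_line_eqI:
  assumes "a \<noteq> 0 \<or> b \<noteq> 0" "a' \<noteq> 0 \<or> b' \<noteq> 0" and par: "a * b' = a' * b"
    and on: "a * p + b * q = c" "a' * p + b' * q = c'"
  shows "coord_line a b c = coord_line a' b' c'"
proof -
  have "a * (x - p) + b * (y - q) = 0 \<longleftrightarrow> a' * (x - p) + b' * (y - q) = 0" for x y
  proof -
    have "a' * (a * (x - p) + b * (y - q)) = a * (a' * (x - p) + b' * (y - q))"
      "b' * (a * (x - p) + b * (y - q)) = b * (a' * (x - p) + b' * (y - q))"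
      using par by (algebra, algebra)
    then show ?thesis using assms(1,2) by auto
  qed
  moreover have "a * x + b * y = c \<longleftrightarrow> a * (x - p) + b * (y - q) = 0"
    "a' * x + b' * y = c' \<longleftrightarrow> a' * (x - p) + b' * (y - q) = 0" for x y
    unfolding on[symmetric] by (simp_all add: algebra_simps)
  ultimately show ?thesis by (auto simp: coord_line_def)
qed

lemma affine_hull_eq_coord_line:
  assumes "(p, q) \<noteq> (u, v)"
  shows "affine hull {(p, q), (u, v)} = coord_line (q - v) (u - p) ((q - v) * p + (u - p) * q)"
    (is "_ = coord_line ?a ?b ?c")
proof (intro set_eqI)
  fix z :: point
  obtain x y where z: "z = (x, y)" by (cases z)
  have s: "?a\<^sup>2 + ?b\<^sup>2 > 0" using assms by (simp add: sum_power2_gt_zero_iff) auto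
  show "z \<in> affine hull {(p, q), (u, v)} \<longleftrightarrow> z \<in> coord_line ?a ?b ?c"
  proof
    assume "z \<in> affine hull {(p, q), (u, v)}"
    then obtain \<alpha> \<beta> where "\<alpha> + \<beta> = 1" and x: "x = \<alpha> * p + \<beta> * u" and y: "y = \<alpha> * q + \<beta> * v"
      unfolding affine_hull_2 z by auto
    then have \<alpha>: "\<alpha> = 1 - \<beta>" by simp
    show "z \<in> coord_line ?a ?b ?c"
      unfolding z x y \<alpha> by (simp add: algebra_simps)
  next
    assume "z \<in> coord_line ?a ?b ?c"
    then have l: "?a * (x - p) + ?b * (y - q) = 0" by (simp add: z algebra_simps)
    define s where "s = ?a\<^sup>2 + ?b\<^sup>2"
    define \<beta> where "\<beta> = (?b * (x - p) - ?a * (y - q)) / s"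
    have \<beta>: "s * \<beta> = ?b * (x - p) - ?a * (y - q)" and "s \<noteq> 0"
      using s unfolding s_def[symmetric] by (simp_all add: \<beta>_def)
    have "s * (?b * \<beta>) = ?b * (s * \<beta>)" by simp
    also have "\<dots> = s * (x - p) - ?a * (?a * (x - p) + ?b * (y - q))"
      unfolding \<beta> unfolding s_def by (simp add: algebra_simps power2_eq_square)
    finally have "?b * \<beta> = x - p" unfolding l using \<open>s \<noteq> 0\<close> by simp
    moreover have "s * (- ?a * \<beta>) = - ?a * (s * \<beta>)" by simp
    then have "s * (- ?a * \<beta>) = s * (y - q) - ?b * (?a * (x - p) + ?b * (y - q))"
      unfolding \<beta> unfolding s_def by (simp add: algebra_simps power2_eq_square)
    then have "- ?a * \<beta> = y - q" unfolding l using \<open>s \<noteq> 0\<close> by (simp del: mult_minus_left)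
    ultimately have "x = (1 - \<beta>) * p + \<beta> * u" "y = (1 - \<beta>) * q + \<beta> * v"
      by (simp_all add: algebra_simps)
    then have "z = (1 - \<beta>) *\<^sub>R (p, q) + \<beta> *\<^sub>R (u, v)" by (simp add: z)
    then show "z \<in> affine hull {(p, q), (u, v)}"
      unfolding affine_hull_2 by (intro CollectI exI[of _ "1 - \<beta>"] exI[of _ \<beta>]) simp
  qed
qed

lemma coord_line_eq_affine_hull:
  fixes a b c :: real
  assumes "a \<noteq> 0 \<or> b \<noteq> 0"
  defines "p \<equiv> a * c / (a\<^sup>2 + b\<^sup>2)" and "q \<equiv> b * c / (a\<^sup>2 + b\<^sup>2)"
  shows "coord_line a b c = affine hull {(p, q), (p + b, q - a)}"
proof -
  have s: "a\<^sup>2 + b\<^sup>2 \<noteq> 0" using normal_pos[OF assms(1)] by linarith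
  have "affine hull {(p, q), (p + b, q - a)} = coord_line a b (a * p + b * q)"
    using assms(1) by (subst affine_hull_eq_coord_line) auto
  also have "a * p + b * q = (a\<^sup>2 + b\<^sup>2) * c / (a\<^sup>2 + b\<^sup>2)"
    by (simp add: p_def q_def add_divide_distrib power2_eq_square algebra_simps)
  also have "\<dots> = c" using s by (rule nonzero_mult_div_cancel_left)
  finally show ?thesis ..
qed

lemma is_line_coord_line:
  assumes "a \<noteq> 0 \<or> b \<noteq> 0"
  shows "is_line (coord_line a b c)"
proof -
  have "(p, q) \<noteq> (p + b, q - a)" for p q using assms by auto
  then show ?thesis
    unfolding is_line_def coord_line_eq_affine_hull[OF assms] by blast
qed

lemma is_lineE:
  assumes "is_line l"
  obtains a b c where "a \<noteq> 0 \<or> b \<noteq> 0" "l = coord_line a b c"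
proof -
  from assms obtain p q u v where "(p, q) \<noteq> (u, v)" "l = affine hull {(p, q), (u, v)}"
    unfolding is_line_def by (metis surj_pair)
  with affine_hull_eq_coord_line[of p q u v] that[of "q - v" "u - p"] show thesis by auto
qed

text \<open>The factor \<open>k\<close>, by which the normal has to be scaled to reach the foot of the perpendicular, is
  kept as a variable tied by an equation without division, so that later computations with folded points stay
  polynomial.\<close>

lemma line_reflection_coord_line:
  assumes "a \<noteq> 0 \<or> b \<noteq> 0" and k: "a * x + b * y - c = k * (a\<^sup>2 + b\<^sup>2)"
  shows "line_reflection (coord_line a b c) (x, y) = (x - 2 * a * k, y - 2 * b * k)"
proof -
  define s where "s = a\<^sup>2 + b\<^sup>2"
  have s: "s > 0" using normal_pos[OF assms(1)] unfolding s_def .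
  have foot: "(x - a * k, y - b * k) \<in> coord_line a b c"
    using k by (simp add: algebra_simps power2_eq_square)
  have near: "dist (x, y) (x - a * k, y - b * k) \<le> dist (x, y) z" if "z \<in> coord_line a b c" for z
  proof -
    obtain u v where z: "z = (u, v)" by (cases z)
    have 1: "a * (x - u) + b * (y - v) = k * s"
      using that k by (simp add: z s_def algebra_simps)
    have "(a * (x - u) + b * (y - v))\<^sup>2 + (a * (y - v) - b * (x - u))\<^sup>2
        = (a\<^sup>2 + b\<^sup>2) * ((x - u)\<^sup>2 + (y - v)\<^sup>2)"
      by (simp add: power2_eq_square algebra_simps)
    then have "(k * s)\<^sup>2 + (a * (y - v) - b * (x - u))\<^sup>2 = s * ((x - u)\<^sup>2 + (y - v)\<^sup>2)"
      unfolding 1 s_def[symmetric] .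
    then have "s * (k\<^sup>2 * s) \<le> s * ((x - u)\<^sup>2 + (y - v)\<^sup>2)"
      using zero_le_power2[of "a * (y - v) - b * (x - u)"] by (simp add: power2_eq_square algebra_simps)
    then have "k\<^sup>2 * s \<le> (x - u)\<^sup>2 + (y - v)\<^sup>2" using s by simp
    then show ?thesis
      by (simp add: z dist_prod_def dist_real_def s_def power_mult_distrib algebra_simps)
  qed
  have "(x - a * k, y - b * k) = closest_point (coord_line a b c) (x, y)"
    by (rule closest_point_unique)
      (use foot near in \<open>auto simp: coord_line_conv_inner convex_hyperplane closed_hyperplane\<close>)
  from this[symmetric] show ?thesis
    by (simp add: line_reflection_def)
qed

lemma reflection_factor:
  fixes a b x y c :: real
  assumes "a \<noteq> 0 \<or> b \<noteq> 0"
  obtains k where "a * x + b * y - c = k * (a\<^sup>2 + b\<^sup>2)"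
proof
  have "a\<^sup>2 + b\<^sup>2 \<noteq> 0" using normal_pos[OF assms] by linarith
  then show "a * x + b * y - c = (a * x + b * y - c) / (a\<^sup>2 + b\<^sup>2) * (a\<^sup>2 + b\<^sup>2)"
    by (metis nonzero_divide_eq_eq)
qed

definition perp_bisector :: "point \<Rightarrow> point \<Rightarrow> line" where
  "perp_bisector P X = coord_line (fst X - fst P) (snd X - snd P)
     (((fst X)\<^sup>2 + (snd X)\<^sup>2 - (fst P)\<^sup>2 - (snd P)\<^sup>2) / 2)"

lemma is_line_perp_bisector: "P \<noteq> X \<Longrightarrow> is_line (perp_bisector P X)"
  unfolding perp_bisector_def by (rule is_line_coord_line) (auto simp: prod_eq_iff)

lemma line_reflection_perp_bisector:
  assumes "P \<noteq> X"
  shows "line_reflection (perp_bisector P X) P = X"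
proof -
  obtain p q x y where [simp]: "P = (p, q)" "X = (x, y)" by (cases P, cases X)
  let ?a = "x - p" and ?b = "y - q"
  have ab: "?a \<noteq> 0 \<or> ?b \<noteq> 0" using assms by auto
  have "?a * p + ?b * q - (x\<^sup>2 + y\<^sup>2 - p\<^sup>2 - q\<^sup>2) / 2 = (- 1 / 2) * (?a\<^sup>2 + ?b\<^sup>2)"
    by (simp add: power2_eq_square field_simps)
  from line_reflection_coord_line[OF ab this] show ?thesis
    by (simp add: perp_bisector_def diff_divide_distrib)
qed

text \<open>A fold that moves a point is determined by where the point goes. This turns a condition on the
  fold line into a condition on the image of one point.\<close>

lemma line_eq_perp_bisector:
  assumes "is_line l" "line_reflection l P \<noteq> P"
  shows "l = perp_bisector P (line_reflection l P)"
proof -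
  obtain a b c where ab: "a \<noteq> 0 \<or> b \<noteq> 0" and l: "l = coord_line a b c"
    using is_lineE[OF assms(1)] .
  obtain p q where P: "P = (p, q)" by (cases P)
  define s where "s = a\<^sup>2 + b\<^sup>2"
  have s: "s > 0" using normal_pos[OF ab] unfolding s_def .
  define k where "k = (a * p + b * q - c) / s"
  have c: "c = a * p + b * q - k * s" using s by (simp add: k_def)
  have X: "line_reflection l P = (p - 2 * a * k, q - 2 * b * k)"
    unfolding l P by (rule line_reflection_coord_line[OF ab]) (simp add: c s_def)
  then have k: "k \<noteq> 0" using assms(2) P by auto
  have "coord_line a b c = coord_line (- 2 * a * k) (- 2 * b * k)
      (((p - 2 * a * k)\<^sup>2 + (q - 2 * b * k)\<^sup>2 - p\<^sup>2 - q\<^sup>2) / 2)"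
    using ab k
    by (intro coord_line_eqI[where p = "p - a * k" and q = "q - b * k"])
       (auto simp: c s_def power2_eq_square field_simps)
  then show ?thesis
    unfolding X by (simp add: l P perp_bisector_def)
qed

section \<open>Arithmetic by single folds\<close>

lemma line_reflection_involutive:
  assumes "is_line l"
  shows "line_reflection l (line_reflection l P) = P"
proof -
  obtain a b c where ab: "a \<noteq> 0 \<or> b \<noteq> 0" and l: "l = coord_line a b c"
    using is_lineE[OF assms] .
  obtain p q where P: "P = (p, q)" by (cases P)
  obtain k where k: "a * p + b * q - c = k * (a\<^sup>2 + b\<^sup>2)" using ab by (rule reflection_factor)
  then have "a * (p - 2 * a * k) + b * (q - 2 * b * k) - c = (- k) * (a\<^sup>2 + b\<^sup>2)"
    by (simp add: algebra_simps power2_eq_square)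
  from line_reflection_coord_line[OF ab this] line_reflection_coord_line[OF ab k]
  show ?thesis by (simp add: l P)
qed

lemma origami_line_through:
  assumes P: "origami_point E P" and Q: "origami_point E Q" and "P \<noteq> Q"
  shows "origami_line E (affine hull {P, Q})"
proof -
  let ?A = "{Point_On_Line (Point1 P) Fold1, Point_On_Line (Point1 Q) Fold1}"
  have "l = affine hull {P, Q}" if l: "is_line l" "P \<in> l" "Q \<in> l" for l
  proof -
    obtain p q u v where [simp]: "P = (p, q)" "Q = (u, v)" by (cases P, cases Q)
    from l(1) obtain a b c where ab: "a \<noteq> 0 \<or> b \<noteq> 0" and l': "l = coord_line a b c"
      by (rule is_lineE)
    from l have on: "a * p + b * q = c" "a * u + b * v = c" by (simp_all add: l')
    have "(p, q) \<noteq> (u, v)" using \<open>P \<noteq> Q\<close> by simp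
    moreover from on have "a * (u - p) = (q - v) * b" by (simp add: algebra_simps)
    ultimately have "l = coord_line (q - v) (u - p) ((q - v) * p + (u - p) * q)"
      unfolding l' using ab on(1) by (intro coord_line_eqI[where p = p and q = q]) auto
    then show ?thesis using \<open>(p, q) \<noteq> (u, v)\<close> by (simp add: affine_hull_eq_coord_line)
  qed
  moreover have "is_line (affine hull {P, Q})" unfolding is_line_def using \<open>P \<noteq> Q\<close> by blast
  moreover have "P \<in> affine hull {P, Q}" "Q \<in> affine hull {P, Q}" by (auto intro: hull_inc)
  moreover have "solutions1 ?A = {l. is_line l \<and> P \<in> l \<and> Q \<in> l}"
    by (simp add: solutions1_def)
  ultimately have "solutions1 ?A = {affine hull {P, Q}}" by blast
  then show ?thesis
    by (intro one_fold[of ?A]) (auto simp: given_points1_def given_lines1_def P Q)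
qed

text \<open>A line is mapped to itself by the fold along each of its perpendiculars and by the fold along
  itself only, so folding it onto itself through a given point leaves at most two fold lines.\<close>

lemma origami_line_perpendicular:
  assumes P: "origami_point E (p, q)" and m: "origami_line E (coord_line a b c)"
    and ab: "a \<noteq> 0 \<or> b \<noteq> 0"
  shows "origami_line E (coord_line b (- a) (b * p - a * q))"
proof -
  let ?m = "coord_line a b c" and ?perp = "coord_line b (- a) (b * p - a * q)"
  let ?A = "{Point_On_Line (Point1 (p, q)) Fold1, Lines_Coincide (Folded_Line1 ?m) (Line1 ?m)}"
  have "l = ?m \<or> l = ?perp"
    if l: "is_line l" "(p, q) \<in> l" "line_reflection l ` ?m = ?m" for l
  proof -
    from l(1) obtain a' b' c' where ab': "a' \<noteq> 0 \<or> b' \<noteq> 0" and l': "l = coord_line a' b' c'"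
      by (rule is_lineE)
    have c': "a' * p + b' * q = c'" using l(2) by (simp add: l')
    \<comment> \<open>a point of \<open>m\<close> moves along the normal of \<open>l\<close>, so it leaves \<open>m\<close> unless it lies on \<open>l\<close> or the lines are
      perpendicular\<close>
    have *: "a' * x + b' * y = c' \<or> a * a' + b * b' = 0" if "a * x + b * y = c" for x y
    proof -
      obtain k where k: "a' * x + b' * y - c' = k * (a'\<^sup>2 + b'\<^sup>2)"
        using ab' by (rule reflection_factor)
      have "(x - 2 * a' * k, y - 2 * b' * k) \<in> ?m"
        using imageI[of "(x, y)" ?m "line_reflection l"] l(3) that
          line_reflection_coord_line[OF ab' k] unfolding l' by simp
      with that have "k * (a * a' + b * b') = 0" by (simp add: algebra_simps)
      with k show ?thesis by auto
    qed
    show ?thesis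
    proof (cases "a * a' + b * b' = 0")
      case True
      then have "a' * - a = b * b'" by (simp add: algebra_simps)
      moreover have "b \<noteq> 0 \<or> - a \<noteq> 0" using ab by auto
      ultimately have "l = ?perp"
        unfolding l' using ab' c' by (intro coord_line_eqI[where p = p and q = q]) simp_all
      then show ?thesis ..
    next
      case False
      define s where "s = a\<^sup>2 + b\<^sup>2"
      have s: "s \<noteq> 0" using normal_pos[OF ab] unfolding s_def by linarith
      \<comment> \<open>two points of \<open>m\<close>\<close>
      let ?x = "a * c / s" and ?y = "b * c / s"
      have "a * ?x + b * ?y = s * c / s"
        by (simp add: s_def add_divide_distrib power2_eq_square algebra_simps)
      then have on: "a * ?x + b * ?y = c" using s by simp
      then have on2: "a * (?x + b) + b * (?y - a) = c" by (simp add: algebra_simps)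
      have e1: "a' * ?x + b' * ?y = c'" using *[OF on] False by blast
      have e2: "a' * (?x + b) + b' * (?y - a) = c'" using *[OF on2] False by blast
      have "a' * (?x + b) + b' * (?y - a) - (a' * ?x + b' * ?y) = a' * b - a * b'"
        by (simp add: algebra_simps)
      then have "a' * b = a * b'" unfolding e1 e2 by simp
      then have "l = ?m"
        unfolding l' by (rule coord_line_eqI[OF ab' ab _ e1 on])
      then show ?thesis ..
    qed
  qed
  then have "solutions1 ?A \<subseteq> {?m, ?perp}" by (auto simp: solutions1_def)
  then have fin: "finite (solutions1 ?A)" by (rule finite_subset) simp
  have ab': "b \<noteq> 0 \<or> - a \<noteq> 0" using ab by auto
  have line: "is_line ?perp" using ab' by (rule is_line_coord_line)
  have sub: "line_reflection ?perp z \<in> ?m" if z: "z \<in> ?m" for z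
  proof -
    obtain x y where [simp]: "z = (x, y)" by (cases z)
    obtain k where "b * x + - a * y - (b * p - a * q) = k * (b\<^sup>2 + (- a)\<^sup>2)"
      using ab' by (rule reflection_factor)
    from line_reflection_coord_line[OF ab' this] show ?thesis using z by (simp add: algebra_simps)
  qed
  have "line_reflection ?perp ` ?m = ?m"
  proof (intro subset_antisym subsetI)
    fix z assume "z \<in> ?m"
    then show "z \<in> line_reflection ?perp ` ?m"
      using sub line_reflection_involutive[OF line, of z] by (metis imageI)
  qed (use sub in blast)
  with line have "?perp \<in> solutions1 ?A" by (auto simp: solutions1_def)
  with fin show ?thesis
    by (intro one_fold[of ?A]) (auto simp: given_points1_def given_lines1_def P m)
qed

lemma origami_point_meet:
  assumes "origami_line E (coord_line a b c)" "origami_line E (coord_line a' b' c')"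
    and det: "a * b' \<noteq> a' * b"
    and on: "a * x + b * y = c" "a' * x + b' * y = c'"
  shows "origami_point E (x, y)"
proof (rule intersection[OF assms(1,2)])
  have *: "u = x \<and> v = y" if "a * u + b * v = c" "a' * u + b' * v = c'" for u v
  proof -
    have "a * (u - x) + b * (v - y) = 0" "a' * (u - x) + b' * (v - y) = 0"
      using that on by (simp_all add: algebra_simps)
    moreover have "(a * b' - a' * b) * (u - x)
        = b' * (a * (u - x) + b * (v - y)) - b * (a' * (u - x) + b' * (v - y))"
      "(a * b' - a' * b) * (v - y)
        = a * (a' * (u - x) + b' * (v - y)) - a' * (a * (u - x) + b * (v - y))"
      by (simp_all add: algebra_simps)
    ultimately have "(a * b' - a' * b) * (u - x) = 0" "(a * b' - a' * b) * (v - y) = 0"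
      by simp_all
    then show ?thesis using det by simp
  qed
  show "coord_line a b c \<inter> coord_line a' b' c' = {(x, y)}"
  proof (intro subset_antisym subsetI)
    fix z assume "z \<in> coord_line a b c \<inter> coord_line a' b' c'"
    then show "z \<in> {(x, y)}" using *[of "fst z" "snd z"] by (cases z) simp
  next
    fix z assume "z \<in> {(x, y)}"
    then show "z \<in> coord_line a b c \<inter> coord_line a' b' c'" using on by simp
  qed
qed

definition constructibles :: "real set \<Rightarrow> real set" where
  "constructibles E = {r. two_fold_constructible E r}"

lemma constructibles_iff: "r \<in> constructibles E \<longleftrightarrow> origami_point E (r, 0)"
  by (simp add: constructibles_def two_fold_constructible_def)

context
  fixes E :: "real set"
begin

lemma x_axis: "origami_line E (coord_line 0 1 0)"
  using origami_line_through[OF origin unit_x, of E] by (simp add: affine_hull_eq_coord_line)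

lemma y_axis: "origami_line E (coord_line 1 0 0)"
  using origami_line_perpendicular[OF origin x_axis] by simp

lemma zero_constructible: "0 \<in> constructibles E" and one_constructible: "1 \<in> constructibles E"
  by (simp_all add: constructibles_iff origin unit_x)

lemma vertical_line: "origami_point E (x, y) \<Longrightarrow> origami_line E (coord_line 1 0 x)"
  using origami_line_perpendicular[OF _ x_axis] by simp

lemma horizontal_line:
  assumes "origami_point E (x, y)"
  shows "origami_line E (coord_line 0 1 y)"
proof -
  have "origami_line E (coord_line 0 (- 1) (- y))"
    using origami_line_perpendicular[OF assms y_axis] by simp
  also have "coord_line 0 (- 1) (- y) = coord_line 0 1 y" by (auto simp: coord_line_def)
  finally show ?thesis .
qed

lemma diagonal_line: "origami_line E (coord_line 1 (- 1) 0)"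
proof -
  have "origami_point E (1, 1)"
    using origami_point_meet[OF vertical_line[OF unit_x] horizontal_line[OF unit_y]] by simp
  from origami_line_through[OF origin this] have "origami_line E (coord_line (- 1) 1 0)"
    by (simp add: affine_hull_eq_coord_line)
  also have "coord_line (- 1) 1 0 = coord_line 1 (- 1) 0" by (auto simp: coord_line_def)
  finally show ?thesis .
qed

lemma origami_point_swap:
  assumes "origami_point E (x, y)"
  shows "origami_point E (y, x)"
proof -
  have "line_reflection (coord_line 1 (- 1) 0) (x, y) = (x - 2 * 1 * ((x - y) / 2), y - 2 * (- 1) * ((x - y) / 2))"
    by (rule line_reflection_coord_line) simp_all
  with folded_point[OF assms diagonal_line] show ?thesis by (simp add: diff_divide_distrib)
qed

lemma origami_point_iff: "origami_point E (x, y) \<longleftrightarrow> x \<in> constructibles E \<and> y \<in> constructibles E"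
proof
  have *: "u \<in> constructibles E" if "origami_point E (u, v)" for u v
    using origami_point_meet[OF vertical_line[OF that] x_axis, of u 0]
    by (simp add: constructibles_iff)
  assume "origami_point E (x, y)"
  with *[of x y] *[of y x] origami_point_swap[of x y] show "x \<in> constructibles E \<and> y \<in> constructibles E" by simp
next
  assume "x \<in> constructibles E \<and> y \<in> constructibles E"
  then have "origami_line E (coord_line 1 0 x)" "origami_line E (coord_line 0 1 y)"
    by (auto simp: constructibles_iff intro: vertical_line horizontal_line[OF origami_point_swap])
  then show "origami_point E (x, y)" by (rule origami_point_meet) simp_all
qed

lemma uminus_constructible:
  assumes "x \<in> constructibles E"
  shows "- x \<in> constructibles E"
proof -
  have "line_reflection (coord_line 1 0 0) (x, 0) = (x - 2 * 1 * x, 0 - 2 * 0 * x)"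
    by (rule line_reflection_coord_line) simp_all
  with assms folded_point[OF _ y_axis, of "(x, 0)"] show ?thesis
    by (simp add: constructibles_iff)
qed

text \<open>The perpendicular to the diagonal \<open>x = y\<close> through \<open>(x, 0)\<close> has slope \<open>- 1\<close>, hence meets the vertical at
  \<open>- y\<close> at height \<open>x + y\<close>.\<close>

lemma add_constructible:
  assumes "x \<in> constructibles E" "y \<in> constructibles E"
  shows "x + y \<in> constructibles E"
proof -
  have "origami_point E (x, 0)" "origami_point E (- y, 0)"
    using assms uminus_constructible by (simp_all add: constructibles_iff)
  then have "origami_line E (coord_line (- 1) (- 1) (- x))" "origami_line E (coord_line 1 0 (- y))"
    using origami_line_perpendicular[OF _ diagonal_line] vertical_line by force+
  then have "origami_point E (- y, x + y)" by (rule origami_point_meet) simp_all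
  then show ?thesis by (simp only: origami_point_iff)
qed

lemma diff_constructible: "x \<in> constructibles E \<Longrightarrow> y \<in> constructibles E \<Longrightarrow> x - y \<in> constructibles E"
  using add_constructible[of x "- y"] uminus_constructible[of y] by simp

lemma line_from_origin:
  assumes "x \<in> constructibles E" "y \<in> constructibles E" "x \<noteq> 0"
  shows "origami_line E (coord_line (- y) x 0)"
  using origami_line_through[OF origin, of E "(x, y)"] assms
  by (simp add: affine_hull_eq_coord_line origami_point_iff)

text \<open>Similar triangles: the line of slope \<open>x\<close> through the origin has height \<open>x * y\<close> at abscissa \<open>y\<close>.\<close>

lemma mult_constructible:
  assumes "x \<in> constructibles E" "y \<in> constructibles E"
  shows "x * y \<in> constructibles E"
proof -
  have "origami_line E (coord_line (- x) 1 0)"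
    using assms one_constructible by (intro line_from_origin) auto
  moreover have "origami_line E (coord_line 1 0 y)"
    using assms by (intro vertical_line[of y 0]) (simp add: constructibles_iff)
  ultimately have "origami_point E (y, x * y)" by (rule origami_point_meet) simp_all
  then show ?thesis by (simp only: origami_point_iff)
qed

lemma divide_constructible:
  assumes "x \<in> constructibles E" "y \<in> constructibles E"
  shows "x / y \<in> constructibles E"
proof (cases "y = 0")
  case True
  then show ?thesis using zero_constructible by simp
next
  case False
  have "origami_point E (1, x / y)"
    using line_from_origin[OF assms(2,1) False] vertical_line[OF unit_x]
    by (rule origami_point_meet) (use False in simp_all)
  then show ?thesis by (simp only: origami_point_iff)
qed

lemma power_constructible: "x \<in> constructibles E \<Longrightarrow> x ^ n \<in> constructibles E"
  by (induction n) (use one_constructible mult_constructible in auto)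

lemma of_nat_constructible: "real n \<in> constructibles E"
  using zero_constructible one_constructible add_constructible by (induction n) auto

lemma numeral_constructible: "numeral n \<in> constructibles E"
  using of_nat_constructible[of "numeral n"] by simp

lemma sum_constructible: "(\<And>i. i \<in> A \<Longrightarrow> f i \<in> constructibles E) \<Longrightarrow> sum f A \<in> constructibles E"
  by (induction A rule: infinite_finite_induct) (use zero_constructible add_constructible in auto)

lemmas arithmetic_constructible =
  zero_constructible one_constructible numeral_constructible uminus_constructible add_constructible
  diff_constructible mult_constructible divide_constructible power_constructible

lemma Rats_constructible: "\<rat> \<subseteq> constructibles E"
proof
  fix x :: real assume "x \<in> \<rat>"
  then obtain m n where "x = of_int m / real n" by (auto simp: Rats_eq_int_div_nat)
  moreover have "of_int m \<in> constructibles E"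
    by (cases m rule: int_cases2)
       (use of_nat_constructible uminus_constructible in auto)
  ultimately show "x \<in> constructibles E" using divide_constructible of_nat_constructible by blast
qed

lemma origami_line_coord_line:
  assumes "a \<in> constructibles E" "b \<in> constructibles E" "c \<in> constructibles E" "a \<noteq> 0 \<or> b \<noteq> 0"
  shows "origami_line E (coord_line a b c)"
  unfolding coord_line_eq_affine_hull[OF assms(4)]
  by (intro origami_line_through iffD2[OF origami_point_iff] conjI arithmetic_constructible assms)
     (use assms(4) in auto)

text \<open>Beloch's fold, a common tangent of two parabolas. The first alignment makes the fold line tangent to the
  parabola with focus \<open>(0, 1)\<close> and directrix \<open>y = - 1\<close>; such a tangent is determined by its slope \<open>t\<close>. In the
  second alignment, the abscissa of the folded point \<open>(u, v)\<close> is \<open>u - 2 * t * (t * u - v - t\<^sup>2) / (t\<^sup>2 + 1)\<close>, so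
  sending it to the vertical line at \<open>w\<close> amounts to the cubic equation
  \<open>2 * t ^ 3 - (u + w) * t\<^sup>2 + 2 * v * t + (u - w) = 0\<close>, whose coefficients are at our disposal.\<close>

lemma cubic_root_constructible:
  assumes K: "A \<in> constructibles E" "B \<in> constructibles E" "C \<in> constructibles E" and t: "t ^ 3 + A * t\<^sup>2 + B * t + C = 0"
  shows "t \<in> constructibles E"
proof -
  let ?P = "(0, 1) :: point" and ?m = "coord_line 0 1 (- 1)"
  let ?R = "(C - A, B)" and ?n = "coord_line 1 0 (- C - A)"
  let ?A = "{Point_On_Line (Folded_Point1 ?P) (Line1 ?m), Point_On_Line (Folded_Point1 ?R) (Line1 ?n)}"
  let ?l = "\<lambda>t. coord_line t (- 1) (t\<^sup>2)"
  have nz: "x \<noteq> 0 \<or> (- 1 :: real) \<noteq> 0" for x :: real by simp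
  have bisector: "perp_bisector ?P (2 * x, - 1) = ?l x" for x
    unfolding perp_bisector_def
    by (rule coord_line_eqI[where p = x and q = 0]) (auto simp: power2_eq_square)
  have fold_P: "line_reflection (?l x) ?P = (2 * x, - 1)" for x
    using line_reflection_perp_bisector[of ?P "(2 * x, - 1)"] by (simp add: bisector)
  have fold_R: "line_reflection (?l x) ?R \<in> ?n \<longleftrightarrow> x ^ 3 + A * x\<^sup>2 + B * x + C = 0" for x
  proof -
    define s where "s = x\<^sup>2 + (- 1)\<^sup>2"
    have s: "s \<noteq> 0" using normal_pos[OF nz[of x]] unfolding s_def by linarith
    define k where "k = (x * (C - A) + - 1 * B - x\<^sup>2) / s"
    have k: "x * (C - A) + - 1 * B - x\<^sup>2 = k * s" using s by (simp add: k_def)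
    have "line_reflection (?l x) ?R \<in> ?n \<longleftrightarrow> C - x * k = 0"
      using line_reflection_coord_line[OF nz k[unfolded s_def]] by auto
    also have "\<dots> \<longleftrightarrow> s * (C - x * k) = 0" using s by simp
    also have "s * (C - x * k) = s * C - x * (k * s)" by (simp add: algebra_simps)
    also have "\<dots> = s * C - x * (x * (C - A) + - 1 * B - x\<^sup>2)" by (simp only: k)
    also have "\<dots> = x ^ 3 + A * x\<^sup>2 + B * x + C"
      unfolding s_def by (simp add: algebra_simps power2_eq_square power3_eq_cube)
    finally show ?thesis .
  qed
  have "finite {x. poly [:C, B, A, 1:] x = 0}" by (rule poly_roots_finite) simp
  then have "finite {x. x ^ 3 + A * x\<^sup>2 + B * x + C = 0}"
    by (simp add: algebra_simps power2_eq_square power3_eq_cube)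
  moreover have "solutions1 ?A \<subseteq> ?l ` {x. x ^ 3 + A * x\<^sup>2 + B * x + C = 0}"
  proof
    fix l assume "l \<in> solutions1 ?A"
    then have l: "is_line l" "line_reflection l ?P \<in> ?m" "line_reflection l ?R \<in> ?n"
      by (auto simp: solutions1_def)
    from l(2) obtain u where u: "line_reflection l ?P = (u, - 1)"
      by (cases "line_reflection l ?P") simp
    then have "l = perp_bisector ?P (2 * (u / 2), - 1)" using line_eq_perp_bisector[OF l(1), of ?P] by (simp add: u)
    then have "l = ?l (u / 2)" by (simp only: bisector)
    with l(3) fold_R show "l \<in> ?l ` {x. x ^ 3 + A * x\<^sup>2 + B * x + C = 0}" by blast
  qed
  ultimately have fin: "finite (solutions1 ?A)" using finite_surj by blast
  have "?l t \<in> solutions1 ?A"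
    using t by (auto simp: solutions1_def is_line_coord_line fold_P fold_R simp del: mem_coord_line)
       (simp add: fold_P)
  then have "origami_line E (?l t)"
    using fin
    by (intro one_fold[of ?A])
       (auto simp: given_points1_def given_lines1_def origami_point_iff
             intro!: origami_line_coord_line arithmetic_constructible K)
  from folded_point[OF _ this, of ?P] have "2 * t \<in> constructibles E"
    by (simp add: fold_P origami_point_iff arithmetic_constructible)
  from divide_constructible[OF this numeral_constructible[of "num.Bit0 num.One"]] show ?thesis
    by simp
qed

text \<open>A square root solves the cubic \<open>x ^ 3 - a * x = 0\<close>.\<close>

lemma sqrt_constructible:
  assumes "a \<in> constructibles E" "x\<^sup>2 = a"
  shows "x \<in> constructibles E"
proof (rule cubic_root_constructible)
  show "0 \<in> constructibles E" "- a \<in> constructibles E" "0 \<in> constructibles E"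
    using assms(1) by (intro arithmetic_constructible; assumption?)+
  show "x ^ 3 + 0 * x\<^sup>2 + - a * x + 0 = 0"
    unfolding assms(2)[symmetric] by (simp add: power2_eq_square power3_eq_cube)
qed

end

section \<open>Equations of degree two and four\<close>

context
  fixes E :: "real set"
begin

lemma quadratic_root_constructible:
  assumes K: "b \<in> constructibles E" "c \<in> constructibles E" and x: "x\<^sup>2 + b * x + c = 0"
  shows "x \<in> constructibles E"
proof -
  have "(x + b / 2)\<^sup>2 = b\<^sup>2 / 4 - c"
    using x by (simp add: power2_eq_square field_simps)
  then have "x + b / 2 \<in> constructibles E"
    by (rule sqrt_constructible[rotated]) (intro arithmetic_constructible K)
  moreover have "b / 2 \<in> constructibles E" by (intro arithmetic_constructible K)
  ultimately have "x + b / 2 - b / 2 \<in> constructibles E" by (rule diff_constructible)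
  then show ?thesis by simp
qed

text \<open>Descartes' method. A real quartic without cubic term is a product
  \<open>(y\<^sup>2 + u * y + v) * (y\<^sup>2 - u * y + w)\<close> of real factors, where \<open>u\<^sup>2\<close> is a root of the resolvent cubic. The resolvent has
  the value \<open>- q\<^sup>2\<close> at zero, so for \<open>q \<noteq> 0\<close> it has a positive root and \<open>u\<close> is real; for \<open>q = 0\<close> the
  quartic is a quadratic in \<open>y\<^sup>2\<close>.\<close>

lemma depressed_quartic_root_constructible:
  assumes K: "p \<in> constructibles E" "q \<in> constructibles E" "r \<in> constructibles E"
    and y: "y ^ 4 + p * y\<^sup>2 + q * y + r = 0"
  shows "y \<in> constructibles E"
proof (cases "q = 0")
  case True
  then have "(y\<^sup>2)\<^sup>2 + p * y\<^sup>2 + r = 0" using y by simp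
  then have "y\<^sup>2 \<in> constructibles E" by (rule quadratic_root_constructible[OF K(1,3)])
  then show ?thesis by (rule sqrt_constructible) simp
next
  case False
  define f where "f = (\<lambda>z. z ^ 3 + 2 * p * z\<^sup>2 + (p\<^sup>2 - 4 * r) * z - q\<^sup>2)"
  \<comment> \<open>a bound for the roots, by the sum of the absolute values of the coefficients\<close>
  define M where "M = 1 + \<bar>2 * p\<bar> + \<bar>p\<^sup>2 - 4 * r\<bar> + q\<^sup>2"
  have "1 \<le> M" by (simp add: M_def)
  have "f M > 0"
  proof -
    have M: "1 \<le> M\<^sup>2" "M \<le> M\<^sup>2" using \<open>1 \<le> M\<close> by (simp_all add: power2_eq_square mult_le_cancel_left1)
        (use mult_mono[of 1 M 1 M] in simp)
    have "- \<bar>2 * p\<bar> * M\<^sup>2 \<le> 2 * p * M\<^sup>2" by (intro mult_right_mono) auto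
    moreover have "- \<bar>p\<^sup>2 - 4 * r\<bar> * M\<^sup>2 \<le> - \<bar>p\<^sup>2 - 4 * r\<bar> * M"
      using mult_left_mono[OF M(2), of "\<bar>p\<^sup>2 - 4 * r\<bar>"] by simp
    moreover have "- \<bar>p\<^sup>2 - 4 * r\<bar> * M \<le> (p\<^sup>2 - 4 * r) * M"
      using \<open>1 \<le> M\<close> by (intro mult_right_mono) auto
    moreover have "q\<^sup>2 * 1 \<le> q\<^sup>2 * M\<^sup>2" using M(1) by (intro mult_left_mono) auto
    moreover have "M ^ 3 = M\<^sup>2 * (1 + \<bar>2 * p\<bar> + \<bar>p\<^sup>2 - 4 * r\<bar> + q\<^sup>2)"
      unfolding M_def[symmetric] by (simp add: power3_eq_cube power2_eq_square)
    then have "M ^ 3 = M\<^sup>2 + \<bar>2 * p\<bar> * M\<^sup>2 + \<bar>p\<^sup>2 - 4 * r\<bar> * M\<^sup>2 + q\<^sup>2 * M\<^sup>2"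
      by (simp add: algebra_simps)
    ultimately show ?thesis using M(1) unfolding f_def by linarith
  qed
  moreover have "f 0 < 0" using False by (simp add: f_def)
  moreover have "continuous_on {0..M} f" unfolding f_def by (intro continuous_intros)
  ultimately obtain z where z: "0 \<le> z" "f z = 0"
    using IVT'[of f 0 0 M] \<open>1 \<le> M\<close> by force
  have "z \<noteq> 0" using z(2) \<open>f 0 < 0\<close> by auto
  have "z ^ 3 + 2 * p * z\<^sup>2 + (p\<^sup>2 - 4 * r) * z + (- q\<^sup>2) = 0" using z(2) by (simp add: f_def)
  then have zK: "z \<in> constructibles E"
    by (rule cubic_root_constructible[rotated 3]) (intro arithmetic_constructible K)+
  define u where "u = sqrt z"
  have u: "u\<^sup>2 = z" "u \<noteq> 0" using z(1) \<open>z \<noteq> 0\<close> by (simp_all add: u_def)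
  have uK: "u \<in> constructibles E" using zK u(1) by (rule sqrt_constructible)
  define v where "v = (p + z - q / u) / 2"
  define w where "w = (p + z + q / u) / 2"
  have vK: "v \<in> constructibles E" and wK: "w \<in> constructibles E"
    unfolding v_def w_def by (intro arithmetic_constructible K uK zK)+
  have "(y\<^sup>2 + u * y + v) * (y\<^sup>2 + (- u) * y + w)
      = y ^ 4 + (v + w - u\<^sup>2) * y\<^sup>2 + u * (w - v) * y + v * w"
    by (simp add: algebra_simps power2_eq_square power4_eq_xxxx)
  moreover have "v + w - u\<^sup>2 = p" by (simp add: v_def w_def u(1) field_simps)
  moreover have "u * (w - v) = q" using u(2) by (simp add: v_def w_def field_simps)
  moreover have "v * w = r"
  proof -
    have "v * w = ((p + z)\<^sup>2 - q\<^sup>2 / z) / 4"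
      by (simp add: v_def w_def power_divide power2_eq_square algebra_simps flip: u(1))
    moreover have "(p + z)\<^sup>2 - q\<^sup>2 / z = 4 * r"
      using z(2) \<open>z \<noteq> 0\<close>
      by (simp add: f_def power2_eq_square power3_eq_cube field_simps)
    ultimately show ?thesis by simp
  qed
  ultimately have "y\<^sup>2 + u * y + v = 0 \<or> y\<^sup>2 + (- u) * y + w = 0" using y by auto
  then show ?thesis
    using quadratic_root_constructible[OF uK vK] quadratic_root_constructible[OF uminus_constructible[OF uK] wK]
    by blast
qed

lemma quartic_root_constructible:
  assumes K: "a \<in> constructibles E" "b \<in> constructibles E" "c \<in> constructibles E"
      "d \<in> constructibles E" "e \<in> constructibles E"
    and "a \<noteq> 0" and x: "a * x ^ 4 + b * x ^ 3 + c * x\<^sup>2 + d * x + e = 0"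
  shows "x \<in> constructibles E"
proof -
  define B C D G where "B = b / a" "C = c / a" "D = d / a" "G = e / a"
  note defs = this
  have K': "B \<in> constructibles E" "C \<in> constructibles E" "D \<in> constructibles E" "G \<in> constructibles E"
    unfolding defs by (intro arithmetic_constructible K)+
  have "(a * x ^ 4 + b * x ^ 3 + c * x\<^sup>2 + d * x + e) / a = 0" using x by simp
  then have x': "x ^ 4 + B * x ^ 3 + C * x\<^sup>2 + D * x + G = 0"
    using \<open>a \<noteq> 0\<close> by (simp add: defs add_divide_distrib)
  define y where "y = x + B / 4"
  have xy: "x = y - B / 4" by (simp add: y_def)
  have "y ^ 4 + (C - 3 * B\<^sup>2 / 8) * y\<^sup>2 + (D - B * C / 2 + B ^ 3 / 8) * y
      + (G - B * D / 4 + B\<^sup>2 * C / 16 - 3 * B ^ 4 / 256) = 0"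
    using x' unfolding xy
    by (simp add: power2_eq_square power3_eq_cube power4_eq_xxxx field_simps)
  then have "y \<in> constructibles E"
    by (rule depressed_quartic_root_constructible[rotated 3]) (intro arithmetic_constructible K')+
  then show ?thesis
    unfolding xy by (rule diff_constructible) (intro arithmetic_constructible K')
qed


end


section \<open>The two-fold step as a septic equation\<close>

context
  fixes E :: "real set"
begin

text \<open>The axiom AL6ab8 in coordinates. The point \<open>Q\<close> is the origin, \<open>S = (- d, 0)\<close>, and the first parabola has focus
  \<open>(0, (e - \<sigma>\<^sup>2) / (2 * \<sigma>))\<close> and directrix \<open>y = (e + \<sigma>\<^sup>2) / (2 * \<sigma>)\<close>, so that its tangents are the lines
  \<open>t * x + \<sigma> * y = (t\<^sup>2 + e) / 2\<close>, and \<open>Q\<close> is folded to \<open>X t = (t * g t, \<sigma> * g t)\<close>. The second parabola has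
  focus \<open>S + (\<phi>\<^sub>1, \<phi>\<^sub>2)\<close> and a directrix with normal \<open>(a, b)\<close>, whose signed distance from the focus is \<open>\<delta>\<close> divided by the length of the normal. With
  \<open>(y\<^sub>1, y\<^sub>2) = X t - S\<close>, the equation \<open>H t = 0\<close> says that \<open>X t\<close> lies on the cubic traced out by the images of \<open>S\<close> under
  the folds along the tangents of the second parabola.

  Because \<open>S\<close> differs from \<open>Q\<close> and lies on the horizontal line through \<open>Q\<close>, no \<open>X t\<close> is equal to \<open>S\<close>: the second
  coordinate of \<open>X t\<close> vanishes only if \<open>X t = Q\<close>. Hence every \<open>t\<close> determines both fold lines, and the solutions of
  the alignments correspond to the zeros of \<open>H\<close>.\<close>

lemma two_fold_parameter_constructible:
  fixes \<sigma> e d a b \<phi>\<^sub>1 \<phi>\<^sub>2 \<delta> :: real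
  defines "g \<equiv> \<lambda>t. (t\<^sup>2 + e) / (t\<^sup>2 + \<sigma>\<^sup>2)"
  defines "y\<^sub>1 \<equiv> \<lambda>t. d + t * g t" and "y\<^sub>2 \<equiv> \<lambda>t. \<sigma> * g t"
  defines "H \<equiv> \<lambda>t. (a * y\<^sub>1 t + b * y\<^sub>2 t) * ((y\<^sub>1 t)\<^sup>2 + (y\<^sub>2 t)\<^sup>2 - 2 * (\<phi>\<^sub>1 * y\<^sub>1 t + \<phi>\<^sub>2 * y\<^sub>2 t))
      - \<delta> * ((y\<^sub>1 t)\<^sup>2 + (y\<^sub>2 t)\<^sup>2)"
  assumes K: "\<sigma> \<in> constructibles E" "e \<in> constructibles E" "d \<in> constructibles E" "a \<in> constructibles E"
      "b \<in> constructibles E" "\<phi>\<^sub>1 \<in> constructibles E" "\<phi>\<^sub>2 \<in> constructibles E" "\<delta> \<in> constructibles E"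
    and \<sigma>: "\<sigma> > 0" and d: "d \<noteq> 0" and ab: "a \<noteq> 0 \<or> b \<noteq> 0"
    and fin: "finite {t. H t = 0}" and t: "H t = 0"
  shows "t \<in> constructibles E"
proof -
  let ?P = "(0, (e - \<sigma>\<^sup>2) / (2 * \<sigma>))" and ?m = "coord_line 0 1 ((e + \<sigma>\<^sup>2) / (2 * \<sigma>))"
  let ?Q = "(0, 0) :: point" and ?S = "(- d, 0) :: point"
  let ?R = "(\<phi>\<^sub>1 - d, \<phi>\<^sub>2)" and ?n = "coord_line a b (\<delta> + a * (\<phi>\<^sub>1 - d) + b * \<phi>\<^sub>2)"
  let ?A = "{Point_On_Line (Folded_Point_a ?P) (Line2 ?m), Point_On_Line (Folded_Point_b ?R) (Line2 ?n),
    Points_Coincide (Folded_Point_a ?Q) (Folded_Point_b ?S)}"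
  define la where "la x = coord_line x \<sigma> ((x\<^sup>2 + e) / 2)" for x
  define X where "X x = (x * g x, \<sigma> * g x)" for x
  define lb where "lb x = perp_bisector ?S (X x)" for x
  have nz: "x \<noteq> 0 \<or> \<sigma> \<noteq> 0" for x :: real using \<sigma> by simp
  have ne: "?P \<noteq> (x, (e + \<sigma>\<^sup>2) / (2 * \<sigma>))" for x
    using \<sigma> by (simp add: divide_simps)
  have bisector: "perp_bisector ?P (x, (e + \<sigma>\<^sup>2) / (2 * \<sigma>)) = la x" for x
    unfolding perp_bisector_def la_def
    by (rule coord_line_eqI[where p = "x / 2" and q = "e / (2 * \<sigma>)"])
       (use \<sigma> in \<open>auto simp: power2_eq_square field_simps\<close>)
  have fold_P: "line_reflection (la x) ?P = (x, (e + \<sigma>\<^sup>2) / (2 * \<sigma>))" for x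
    using line_reflection_perp_bisector[OF ne[of x]] unfolding bisector .
  have fold_Q: "line_reflection (la x) ?Q = X x" for x
  proof -
    have s: "x\<^sup>2 + \<sigma>\<^sup>2 \<noteq> 0" using normal_pos[OF nz[of x]] by linarith
    have "g x * (x\<^sup>2 + \<sigma>\<^sup>2) = x\<^sup>2 + e"
      using s unfolding g_def by (metis nonzero_divide_eq_eq)
    then have "x * 0 + \<sigma> * 0 - (x\<^sup>2 + e) / 2 = (- g x / 2) * (x\<^sup>2 + \<sigma>\<^sup>2)" by simp
    from line_reflection_coord_line[OF nz this] show ?thesis by (simp add: la_def X_def)
  qed
  have y_nz: "y\<^sub>1 x \<noteq> 0 \<or> y\<^sub>2 x \<noteq> 0" for x using \<sigma> d by (auto simp: y\<^sub>1_def y\<^sub>2_def)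
  have SX: "?S \<noteq> X x" for x
    using y_nz[of x] unfolding X_def y\<^sub>1_def y\<^sub>2_def by auto
  have fold_S: "line_reflection (lb x) ?S = X x" for x
    unfolding lb_def by (rule line_reflection_perp_bisector[OF SX])
  have fold_R: "line_reflection (lb x) ?R \<in> ?n \<longleftrightarrow> H x = 0" for x
  proof -
    let ?y = "y\<^sub>1 x" and ?z = "y\<^sub>2 x"
    define c where "c = ((x * g x)\<^sup>2 + (\<sigma> * g x)\<^sup>2 - d\<^sup>2) / 2"
    have X: "x * g x = ?y - d" "\<sigma> * g x = ?z" by (simp_all add: y\<^sub>1_def y\<^sub>2_def)
    have lb: "lb x = coord_line ?y ?z c"
      by (simp add: lb_def X_def perp_bisector_def c_def X)
    obtain k where k: "?y * (\<phi>\<^sub>1 - d) + ?z * \<phi>\<^sub>2 - c = k * (?y\<^sup>2 + ?z\<^sup>2)"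
      using y_nz[of x] by (rule reflection_factor)
    have "line_reflection (lb x) ?R \<in> ?n \<longleftrightarrow> - 2 * k * (a * ?y + b * ?z) - \<delta> = 0"
      unfolding lb line_reflection_coord_line[OF y_nz k] by (auto simp: algebra_simps)
    also have "\<dots> \<longleftrightarrow> (?y\<^sup>2 + ?z\<^sup>2) * (- 2 * k * (a * ?y + b * ?z) - \<delta>) = 0"
      using normal_pos[OF y_nz[of x]] by (simp only: mult_eq_0_iff) linarith
    also have "(?y\<^sup>2 + ?z\<^sup>2) * (- 2 * k * (a * ?y + b * ?z) - \<delta>)
        = - 2 * (k * (?y\<^sup>2 + ?z\<^sup>2)) * (a * ?y + b * ?z) - \<delta> * (?y\<^sup>2 + ?z\<^sup>2)"
      by (simp add: algebra_simps)
    also have "k * (?y\<^sup>2 + ?z\<^sup>2) = ?y * \<phi>\<^sub>1 + ?z * \<phi>\<^sub>2 - (?y\<^sup>2 + ?z\<^sup>2) / 2"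
      unfolding k[symmetric] c_def X by (simp add: power2_eq_square field_simps)
    also have "- 2 * \<dots> * (a * ?y + b * ?z) - \<delta> * (?y\<^sup>2 + ?z\<^sup>2) = H x"
      by (simp add: H_def field_simps)
    finally show ?thesis .
  qed
  have "solutions2 ?A \<subseteq> (\<lambda>x. (la x, lb x)) ` {x. H x = 0}"
  proof
    fix ls assume ls: "ls \<in> solutions2 ?A"
    obtain l l' where ll: "ls = (l, l')" by (cases ls)
    from ls have l: "is_line l" "is_line l'" "line_reflection l ?P \<in> ?m" "line_reflection l' ?R \<in> ?n"
      "line_reflection l ?Q = line_reflection l' ?S"
      by (auto simp: solutions2_def ll)
    obtain x where x: "line_reflection l ?P = (x, (e + \<sigma>\<^sup>2) / (2 * \<sigma>))"
      using l(3) by (cases "line_reflection l ?P") simp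
    then have "l = la x"
      using line_eq_perp_bisector[OF l(1), of ?P] ne[of x] by (simp add: bisector)
    moreover from this have "line_reflection l' ?S = X x" using l(5) fold_Q by simp
    then have "l' = lb x"
      using line_eq_perp_bisector[OF l(2), of ?S] SX[of x] unfolding lb_def by simp
    ultimately show "ls \<in> (\<lambda>x. (la x, lb x)) ` {x. H x = 0}"
      using l(4) fold_R ll by auto
  qed
  then have fin': "finite (solutions2 ?A)" using fin finite_surj by blast
  have "is_line (la t)" "is_line (lb t)"
    unfolding la_def lb_def by (intro is_line_coord_line nz is_line_perp_bisector SX)+
  then have "(la t, lb t) \<in> solutions2 ?A"
    using fold_P[of t] fold_Q[of t] fold_S[of t] iffD2[OF fold_R t] by (simp add: solutions2_def)
  moreover have "\<forall>P\<in>given_points2 ?A. origami_point E P"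
    by (simp add: given_points2_def origami_point_iff)
       (intro conjI arithmetic_constructible K)
  moreover have "\<forall>L\<in>given_lines2 ?A. origami_line E L"
    using ab by (simp add: given_lines2_def)
       (intro conjI origami_line_coord_line arithmetic_constructible K; simp)
  ultimately have "origami_line E (la t)"
    using fin' by (intro two_fold_a[of ?A]) auto
  moreover have "origami_point E ?P" 
    unfolding origami_point_iff by (intro conjI arithmetic_constructible K)
  ultimately have "origami_point E (t, (e + \<sigma>\<^sup>2) / (2 * \<sigma>))"
    using folded_point fold_P by metis
  then show ?thesis by (simp only: origami_point_iff)
qed

end

section \<open>Fitting the two-fold step to a given septic\<close>

text \<open>Multiplied by \<open>N\<^sup>2\<close>, where \<open>N = t\<^sup>2 + \<mu>\<close>, the equation of the second cubic along the first one is a septic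
  in \<open>t\<close>, which is given here by its expansion in powers of \<open>q = t\<^sup>2 + e\<close> with linear digits. As \<open>N = q + \<rho>\<close> has the constant
  digit \<open>\<rho>\<close>, the lowest digit has no linear term. The remaining digits \<open>a\<^sub>2\<close>, \<open>b\<^sub>2\<close>, \<open>a\<^sub>3\<close>, \<open>b\<^sub>3\<close> are free,
  while \<open>a\<^sub>1\<close>, \<open>b\<^sub>1\<close>, \<open>b\<^sub>0\<close> depend on \<open>d\<close>, \<open>\<rho>\<close>, and a third parameter \<open>\<kappa>\<close>. The values of \<open>l\<close>, \<open>A\<close>, \<open>B\<close>,
  \<open>C\<close> come from comparing digits from the top.\<close>

lemma septic_identity:
  fixes a\<^sub>2 a\<^sub>3 b\<^sub>2 b\<^sub>3 d e t \<rho> \<kappa> :: real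
  defines "h \<equiv> 2 * a\<^sub>2 - 2 * b\<^sub>3 * d + a\<^sub>3 * d\<^sup>2" and "\<mu> \<equiv> \<rho> + e"
  assumes nz: "t\<^sup>2 + \<mu> \<noteq> 0"
  defines "a\<^sub>1 \<equiv> 2 * \<rho> * d * \<kappa>" and "b\<^sub>1 \<equiv> \<rho> * d\<^sup>2 * \<kappa> + \<rho> * d * h / 2"
    and "b\<^sub>0 \<equiv> \<rho>\<^sup>2 * d\<^sup>2 * \<kappa> - a\<^sub>3 * d ^ 3 * \<rho>\<^sup>2 / 2"
  defines "l \<equiv> b\<^sub>3 - \<kappa> - 3 * a\<^sub>3 * d / 2"
  defines "A \<equiv> 3 * a\<^sub>3 * d / 2 - \<kappa>" and "B \<equiv> 2 * b\<^sub>3 * d - 3 * a\<^sub>3 * d\<^sup>2 - a\<^sub>2"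
    and "C \<equiv> a\<^sub>3 * d * \<mu> - (\<kappa> + 3 * a\<^sub>3 * d / 2) * e - b\<^sub>2 + a\<^sub>2 * d - b\<^sub>3 * d\<^sup>2 + a\<^sub>3 * d ^ 3"
  defines "g \<equiv> (t\<^sup>2 + e) / (t\<^sup>2 + \<mu>)"
  defines "z \<equiv> d + t * g"
  shows "(t\<^sup>2 + \<mu>)\<^sup>2 * ((a\<^sub>3 * z + l * g) * (z\<^sup>2 + \<mu> * g\<^sup>2) - (A * z\<^sup>2 + B * z * g + C * g\<^sup>2))
    = (t\<^sup>2 + e) ^ 3 * (a\<^sub>3 * t + b\<^sub>3) + (t\<^sup>2 + e)\<^sup>2 * (a\<^sub>2 * t + b\<^sub>2) + (t\<^sup>2 + e) * (a\<^sub>1 * t + b\<^sub>1) + b\<^sub>0"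
proof -
  define q where "q = t\<^sup>2 + e"
  define N where "N = q + \<rho>"
  define Z where "Z = d * N + t * q"
  have N: "t\<^sup>2 + \<mu> = N" by (simp add: N_def q_def \<mu>_def)
  have N0: "N \<noteq> 0" using nz N by simp
  have g: "N * g = q" using N0 by (simp add: g_def N flip: q_def)
  have z: "N * z = Z" using g by (simp add: z_def Z_def algebra_simps)
  have "N * (N\<^sup>2 * ((a\<^sub>3 * z + l * g) * (z\<^sup>2 + \<mu> * g\<^sup>2) - (A * z\<^sup>2 + B * z * g + C * g\<^sup>2)))
    = (a\<^sub>3 * (N * z) + l * (N * g)) * ((N * z)\<^sup>2 + \<mu> * (N * g)\<^sup>2)
       - N * (A * (N * z)\<^sup>2 + B * (N * z) * (N * g) + C * (N * g)\<^sup>2)"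
    by (simp add: algebra_simps power2_eq_square)
  also have "\<dots> = (a\<^sub>3 * Z + l * q) * (Z\<^sup>2 + \<mu> * q\<^sup>2) - N * (A * Z\<^sup>2 + B * Z * q + C * q\<^sup>2)"
    by (simp only: g z)
  also have "2 * \<dots> = 2 * (N * (q ^ 3 * (a\<^sub>3 * t + b\<^sub>3) + q\<^sup>2 * (a\<^sub>2 * t + b\<^sub>2) + q * (a\<^sub>1 * t + b\<^sub>1) + b\<^sub>0))"
  proof -
    have e: "e = q - t\<^sup>2" by (simp add: q_def)
    have "2 * l = 2 * b\<^sub>3 - 2 * \<kappa> - 3 * a\<^sub>3 * d" "2 * A = 3 * a\<^sub>3 * d - 2 * \<kappa>"
      "2 * C = 2 * a\<^sub>3 * d * \<mu> - (2 * \<kappa> + 3 * a\<^sub>3 * d) * e - 2 * b\<^sub>2 + 2 * a\<^sub>2 * d - 2 * b\<^sub>3 * d\<^sup>2 + 2 * a\<^sub>3 * d ^ 3"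
      "2 * b\<^sub>1 = 2 * \<rho> * d\<^sup>2 * \<kappa> + \<rho> * d * h" "2 * b\<^sub>0 = 2 * \<rho>\<^sup>2 * d\<^sup>2 * \<kappa> - a\<^sub>3 * d ^ 3 * \<rho>\<^sup>2"
      by (simp_all add: l_def A_def C_def b\<^sub>1_def b\<^sub>0_def field_simps)
    then show ?thesis
      unfolding a\<^sub>1_def B_def h_def \<mu>_def Z_def N_def e by algebra
  qed
  finally show ?thesis using N0 by (simp add: N q_def)
qed


text \<open>For \<open>a \<noteq> 0\<close>, each cubic \<open>(a * y\<^sub>1 + b * y\<^sub>2) * (y\<^sub>1\<^sup>2 + y\<^sub>2\<^sup>2) = A * y\<^sub>1\<^sup>2 + B * y\<^sub>1 * y\<^sub>2 + C * y\<^sub>2\<^sup>2\<close>, that is,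
  each circular cubic with a double point at the origin, has the form of a locus of folded points: its right-hand side
  can be written with a focus \<open>(\<phi>\<^sub>1, \<phi>\<^sub>2)\<close> and a number \<open>\<delta>\<close>. Evaluating both sides at \<open>(b, - a)\<close>, where the linear
  form vanishes, gives \<open>\<delta>\<close>; what remains is divisible by the linear form, with quotient given by the focus.\<close>

lemma circular_cubic_as_fold_locus:
  fixes a b A B C y\<^sub>1 y\<^sub>2 :: real
  assumes "a \<noteq> 0"
  defines "\<delta> \<equiv> (A * b\<^sup>2 - B * a * b + C * a\<^sup>2) / (a\<^sup>2 + b\<^sup>2)"
  defines "\<phi>\<^sub>1 \<equiv> (A - \<delta>) / (2 * a)"
  defines "\<phi>\<^sub>2 \<equiv> (B / 2 - \<phi>\<^sub>1 * b) / a"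
  shows "2 * (\<phi>\<^sub>1 * y\<^sub>1 + \<phi>\<^sub>2 * y\<^sub>2) * (a * y\<^sub>1 + b * y\<^sub>2) + \<delta> * (y\<^sub>1\<^sup>2 + y\<^sub>2\<^sup>2)
    = A * y\<^sub>1\<^sup>2 + B * y\<^sub>1 * y\<^sub>2 + C * y\<^sub>2\<^sup>2"
proof -
  have s: "a\<^sup>2 + b\<^sup>2 \<noteq> 0" using normal_pos[of a b] assms(1) by auto
  then have "\<delta> * (a\<^sup>2 + b\<^sup>2) = A * b\<^sup>2 - B * a * b + C * a\<^sup>2"
    unfolding \<delta>_def by (metis nonzero_divide_eq_eq)
  moreover have 1: "2 * (\<phi>\<^sub>1 * a) = A - \<delta>" using assms(1) by (simp add: \<phi>\<^sub>1_def)
  moreover have 2: "2 * (\<phi>\<^sub>2 * a) = B - 2 * (\<phi>\<^sub>1 * b)" using assms(1) by (simp add: \<phi>\<^sub>2_def)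
  ultimately have "a\<^sup>2 * (2 * (\<phi>\<^sub>2 * b) + \<delta> - C) = 0" by algebra
  then have "2 * (\<phi>\<^sub>2 * b) + \<delta> = C" using assms(1) by simp
  with 1 2 show ?thesis by algebra
qed

context
  fixes E :: "real set"
begin

text \<open>Square roots enter only through \<open>\<sigma> = sqrt (\<rho> + e)\<close>, the distance between focus and directrix of the first parabola. In the
  coordinates of the plane, the second components of the forms in the identity above are rescaled by \<open>\<sigma>\<close>.\<close>

lemma septic_root_constructible_of_parameters:
  fixes a\<^sub>2 a\<^sub>3 b\<^sub>2 b\<^sub>3 d e t \<rho> \<kappa> :: real
  defines "h \<equiv> 2 * a\<^sub>2 - 2 * b\<^sub>3 * d + a\<^sub>3 * d\<^sup>2"
  defines "a\<^sub>1 \<equiv> 2 * \<rho> * d * \<kappa>" and "b\<^sub>1 \<equiv> \<rho> * d\<^sup>2 * \<kappa> + \<rho> * d * h / 2"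
    and "b\<^sub>0 \<equiv> \<rho>\<^sup>2 * d\<^sup>2 * \<kappa> - a\<^sub>3 * d ^ 3 * \<rho>\<^sup>2 / 2"
  defines "F \<equiv> \<lambda>t. (t\<^sup>2 + e) ^ 3 * (a\<^sub>3 * t + b\<^sub>3) + (t\<^sup>2 + e)\<^sup>2 * (a\<^sub>2 * t + b\<^sub>2)
      + (t\<^sup>2 + e) * (a\<^sub>1 * t + b\<^sub>1) + b\<^sub>0"
  assumes K: "a\<^sub>2 \<in> constructibles E" "a\<^sub>3 \<in> constructibles E" "b\<^sub>2 \<in> constructibles E" "b\<^sub>3 \<in> constructibles E"
      "d \<in> constructibles E" "e \<in> constructibles E" "\<rho> \<in> constructibles E" "\<kappa> \<in> constructibles E"
    and "a\<^sub>3 \<noteq> 0" "d \<noteq> 0" "\<rho> + e > 0"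
    and fin: "finite {t. F t = 0}" and t: "F t = 0"
  shows "t \<in> constructibles E"
proof -
  define \<mu> where "\<mu> = \<rho> + e"
  define \<sigma> where "\<sigma> = sqrt \<mu>"
  have \<sigma>: "\<sigma> > 0" and \<sigma>\<mu>: "\<sigma>\<^sup>2 = \<mu>" using \<open>\<rho> + e > 0\<close> by (simp_all add: \<sigma>_def \<mu>_def)
  have \<mu>K: "\<mu> \<in> constructibles E" unfolding \<mu>_def by (intro arithmetic_constructible K)
  then have \<sigma>K: "\<sigma> \<in> constructibles E" using \<sigma>\<mu> by (rule sqrt_constructible)
  define l where "l = b\<^sub>3 - \<kappa> - 3 * a\<^sub>3 * d / 2"
  define A where "A = 3 * a\<^sub>3 * d / 2 - \<kappa>"
  define B where "B = 2 * b\<^sub>3 * d - 3 * a\<^sub>3 * d\<^sup>2 - a\<^sub>2"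
  define C where "C = a\<^sub>3 * d * \<mu> - (\<kappa> + 3 * a\<^sub>3 * d / 2) * e - b\<^sub>2 + a\<^sub>2 * d - b\<^sub>3 * d\<^sup>2 + a\<^sub>3 * d ^ 3"
  have ABC: "l \<in> constructibles E" "A \<in> constructibles E" "B \<in> constructibles E" "C \<in> constructibles E"
    unfolding l_def A_def B_def C_def by (intro arithmetic_constructible K \<mu>K)+
  define b where "b = l / \<sigma>"
  define \<delta> where "\<delta> = (A * b\<^sup>2 - (B / \<sigma>) * a\<^sub>3 * b + (C / \<mu>) * a\<^sub>3\<^sup>2) / (a\<^sub>3\<^sup>2 + b\<^sup>2)"
  define \<phi>\<^sub>1 where "\<phi>\<^sub>1 = (A - \<delta>) / (2 * a\<^sub>3)"
  define \<phi>\<^sub>2 where "\<phi>\<^sub>2 = (B / \<sigma> / 2 - \<phi>\<^sub>1 * b) / a\<^sub>3"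
  have bK: "b \<in> constructibles E" unfolding b_def by (intro arithmetic_constructible ABC \<sigma>K)
  have \<delta>K: "\<delta> \<in> constructibles E"
    unfolding \<delta>_def by (intro arithmetic_constructible ABC K bK \<sigma>K \<mu>K)
  have \<phi>\<^sub>1K: "\<phi>\<^sub>1 \<in> constructibles E" unfolding \<phi>\<^sub>1_def by (intro arithmetic_constructible ABC K \<delta>K)
  have \<phi>\<^sub>2K: "\<phi>\<^sub>2 \<in> constructibles E" unfolding \<phi>\<^sub>2_def by (intro arithmetic_constructible ABC K bK \<sigma>K \<phi>\<^sub>1K)
  define g where "g t = (t\<^sup>2 + e) / (t\<^sup>2 + \<sigma>\<^sup>2)" for t
  define y\<^sub>1 where "y\<^sub>1 t = d + t * g t" for t
  define y\<^sub>2 where "y\<^sub>2 t = \<sigma> * g t" for t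
  define H where "H t = (a\<^sub>3 * y\<^sub>1 t + b * y\<^sub>2 t) * ((y\<^sub>1 t)\<^sup>2 + (y\<^sub>2 t)\<^sup>2 - 2 * (\<phi>\<^sub>1 * y\<^sub>1 t + \<phi>\<^sub>2 * y\<^sub>2 t))
      - \<delta> * ((y\<^sub>1 t)\<^sup>2 + (y\<^sub>2 t)\<^sup>2)" for t
  have H: "H x = 0 \<longleftrightarrow> F x = 0" for x
  proof -
    let ?y = "y\<^sub>1 x" and ?z = "y\<^sub>2 x"
    have N: "x\<^sup>2 + \<mu> \<noteq> 0" using \<sigma> \<sigma>\<mu> by (metis add_nonneg_pos less_irrefl zero_le_power2 zero_less_power)
    have "H x = (a\<^sub>3 * ?y + b * ?z) * (?y\<^sup>2 + ?z\<^sup>2)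
        - (2 * (\<phi>\<^sub>1 * ?y + \<phi>\<^sub>2 * ?z) * (a\<^sub>3 * ?y + b * ?z) + \<delta> * (?y\<^sup>2 + ?z\<^sup>2))"
      by (simp add: H_def algebra_simps)
    also have "2 * (\<phi>\<^sub>1 * ?y + \<phi>\<^sub>2 * ?z) * (a\<^sub>3 * ?y + b * ?z) + \<delta> * (?y\<^sup>2 + ?z\<^sup>2)
        = A * ?y\<^sup>2 + B / \<sigma> * ?y * ?z + C / \<mu> * ?z\<^sup>2"
      unfolding \<delta>_def \<phi>\<^sub>1_def \<phi>\<^sub>2_def by (rule circular_cubic_as_fold_locus[OF \<open>a\<^sub>3 \<noteq> 0\<close>])
    also have "\<dots> = A * ?y\<^sup>2 + B * ?y * g x + C * (g x)\<^sup>2"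
      using \<sigma> by (simp add: y\<^sub>2_def power_mult_distrib flip: \<sigma>\<mu>)
    also have "b * ?z = l * g x" using \<sigma> by (simp add: b_def y\<^sub>2_def)
    also have "?z\<^sup>2 = \<mu> * (g x)\<^sup>2" by (simp add: y\<^sub>2_def power_mult_distrib \<sigma>\<mu>)
    finally have "(x\<^sup>2 + \<mu>)\<^sup>2 * H x = F x"
      using septic_identity[where a\<^sub>2 = a\<^sub>2 and a\<^sub>3 = a\<^sub>3 and b\<^sub>2 = b\<^sub>2 and b\<^sub>3 = b\<^sub>3 and d = d
        and e = e and t = x and \<rho> = \<rho> and \<kappa> = \<kappa>, folded \<mu>_def, OF N]
      unfolding F_def a\<^sub>1_def b\<^sub>1_def b\<^sub>0_def h_def l_def A_def B_def C_def g_def y\<^sub>1_def \<sigma>\<mu>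
      by (simp only:)
    then show ?thesis using N by (metis mult_eq_0_iff power_not_zero)
  qed
  have "finite {t. H t = 0}" "H t = 0" using fin t by (simp_all add: H)
  note this[unfolded H_def y\<^sub>1_def y\<^sub>2_def g_def]
  then show ?thesis
    by (rule two_fold_parameter_constructible[OF \<sigma>K K(6,5,2) bK \<phi>\<^sub>1K \<phi>\<^sub>2K \<delta>K \<sigma> \<open>d \<noteq> 0\<close>
          disjI1[OF \<open>a\<^sub>3 \<noteq> 0\<close>]])
qed

text \<open>Given the digits of a septic, the equations for \<open>b\<^sub>1\<close> and \<open>b\<^sub>0\<close> become \<open>k d = \<rho> * d * h d\<close> and
  \<open>2 * b\<^sub>0 - a\<^sub>1 * d * \<rho> + f 7 * d ^ 3 * \<rho>\<^sup>2 = 0\<close>. Eliminating \<open>\<rho>\<close> leaves the quartic \<open>G d = 0\<close>. The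
  value of \<open>G\<close> at a positive root of \<open>h\<close> has the sign of \<open>f 7\<close>, and at the root of \<open>k\<close> it has the sign of \<open>b\<^sub>0\<close>.
  If these differ, there is a zero \<open>d\<close> in between. The remaining sign conditions put the positive root of the convex
  quadratic \<open>h\<close> to the left of the root of \<open>k\<close>, so that \<open>h d\<close>, \<open>k d\<close>, and therefore \<open>\<rho>\<close>, are positive.\<close>

lemma septic_root_constructible_of_signs:
  fixes f :: "nat \<Rightarrow> real" and e t :: real
  defines "a\<^sub>1 \<equiv> f 3 - 2 * e * f 5 + 3 * e\<^sup>2 * f 7" and "a\<^sub>2 \<equiv> f 5 - 3 * e * f 7"
    and "b\<^sub>0 \<equiv> f 0 - e * f 2 + e\<^sup>2 * f 4 - e ^ 3 * f 6"
    and "b\<^sub>1 \<equiv> f 2 - 2 * e * f 4 + 3 * e\<^sup>2 * f 6" and "b\<^sub>2 \<equiv> f 4 - 3 * e * f 6"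
  assumes K: "\<And>i. f i \<in> constructibles E"
    and e: "f 1 - e * f 3 + e\<^sup>2 * f 5 - e ^ 3 * f 7 = 0"
    and signs: "0 < e" "0 < f 7" "a\<^sub>2 < 0" "0 < a\<^sub>1" "0 < b\<^sub>1" "b\<^sub>0 < 0"
      "0 < a\<^sub>2 * a\<^sub>1\<^sup>2 - 2 * f 6 * b\<^sub>1 * a\<^sub>1 + 2 * b\<^sub>1\<^sup>2 * f 7"
    and t: "(\<Sum>i=0..7. f i * t ^ i) = 0"
  shows "t \<in> constructibles E"
proof -
  define h where "h x = 2 * a\<^sub>2 - 2 * f 6 * x + f 7 * x\<^sup>2" for x
  define k where "k x = 2 * b\<^sub>1 - a\<^sub>1 * x" for x
  define G where "G x = 2 * b\<^sub>0 * (h x)\<^sup>2 - a\<^sub>1 * h x * k x + f 7 * x * (k x)\<^sup>2" for x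
  have cont: "continuous_on S h" "continuous_on S G" for S
    unfolding G_def h_def k_def by (intro continuous_intros)+
  define x\<^sub>k where "x\<^sub>k = 2 * b\<^sub>1 / a\<^sub>1"
  have xk: "0 < x\<^sub>k" "k x\<^sub>k = 0" using signs by (simp_all add: x\<^sub>k_def k_def)
  have "a\<^sub>1\<^sup>2 * h x\<^sub>k = 2 * (a\<^sub>2 * a\<^sub>1\<^sup>2 - 2 * f 6 * b\<^sub>1 * a\<^sub>1 + 2 * b\<^sub>1\<^sup>2 * f 7)"
    using signs by (simp add: h_def x\<^sub>k_def power2_eq_square field_simps)
  then have hk: "h x\<^sub>k > 0" using signs by (metis mult_pos_pos zero_less_numeral zero_less_mult_pos zero_less_power)
  moreover have "h 0 < 0" using signs by (simp add: h_def)
  ultimately obtain x\<^sub>h where "0 \<le> x\<^sub>h" "x\<^sub>h \<le> x\<^sub>k" and h0: "h x\<^sub>h = 0"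
    using IVT'[of h 0 0 x\<^sub>k] cont xk by force
  with hk \<open>h 0 < 0\<close> have xh: "0 < x\<^sub>h" "x\<^sub>h < x\<^sub>k"
    by (metis less_eq_real_def order_less_irrefl)+
  have "k x\<^sub>h > 0"
    using xh(2) signs by (simp add: k_def x\<^sub>k_def field_simps)
  then have "G x\<^sub>h > 0" using h0 xh signs by (simp add: G_def)
  moreover have "G x\<^sub>k < 0" using xk hk signs by (simp add: G_def mult_neg_pos)
  ultimately obtain d where "x\<^sub>h \<le> d" "d \<le> x\<^sub>k" and Gd: "G d = 0"
    using IVT2'[of G x\<^sub>k 0 x\<^sub>h] cont xh by force
  with \<open>G x\<^sub>h > 0\<close> \<open>G x\<^sub>k < 0\<close> have d: "x\<^sub>h < d" "d < x\<^sub>k"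
    by (metis less_eq_real_def order_less_irrefl)+
  then have d0: "d > 0" using xh by simp
  have kd: "k d > 0" using d(2) signs by (simp add: k_def x\<^sub>k_def field_simps)
  \<comment> \<open>the other root of \<open>h\<close> is negative, because the product of the roots is \<open>2 * a\<^sub>2 / f 7\<close>\<close>
  have "x\<^sub>h * h d = (d - x\<^sub>h) * (f 7 * d * x\<^sub>h - 2 * a\<^sub>2)"
    using h0 unfolding h_def by algebra
  moreover have "(d - x\<^sub>h) * (f 7 * d * x\<^sub>h - 2 * a\<^sub>2) > 0"
    using d xh d0 signs by (intro mult_pos_pos) (simp_all add: add_pos_pos less_trans[of _ 0])
  ultimately have hd: "h d > 0" using xh by (metis zero_less_mult_pos)

  define \<rho> where "\<rho> = k d / (d * h d)"
  define \<kappa> where "\<kappa> = a\<^sub>1 / (2 * \<rho> * d)"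
  have \<rho>: "\<rho> > 0" using kd hd d0 by (simp add: \<rho>_def)
  have k\<rho>: "k d = \<rho> * d * h d" using hd d0 by (simp add: \<rho>_def)
  have a1: "a\<^sub>1 = 2 * \<rho> * d * \<kappa>" using \<rho> d0 by (simp add: \<kappa>_def)
  have b1: "b\<^sub>1 = \<rho> * d\<^sup>2 * \<kappa> + \<rho> * d * h d / 2"
    using k\<rho> a1 by (simp add: k_def power2_eq_square algebra_simps)
  have "(h d)\<^sup>2 * (2 * b\<^sub>0 - (2 * \<rho>\<^sup>2 * d\<^sup>2 * \<kappa> - f 7 * d ^ 3 * \<rho>\<^sup>2)) = G d"
    unfolding G_def k\<rho> a1 by (simp add: algebra_simps power2_eq_square power3_eq_cube)
  then have b0: "b\<^sub>0 = \<rho>\<^sup>2 * d\<^sup>2 * \<kappa> - f 7 * d ^ 3 * \<rho>\<^sup>2 / 2" using Gd hd by simp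

  have eK: "e \<in> constructibles E"
  proof (rule cubic_root_constructible)
    show "- (f 5 / f 7) \<in> constructibles E" "f 3 / f 7 \<in> constructibles E" "- (f 1 / f 7) \<in> constructibles E"
      by (intro arithmetic_constructible K)+
    have "e ^ 3 + - (f 5 / f 7) * e\<^sup>2 + f 3 / f 7 * e + - (f 1 / f 7)
        = - (f 1 - e * f 3 + e\<^sup>2 * f 5 - e ^ 3 * f 7) / f 7"
      using signs by (simp add: field_simps)
    then show "e ^ 3 + - (f 5 / f 7) * e\<^sup>2 + f 3 / f 7 * e + - (f 1 / f 7) = 0" unfolding e by simp
  qed
  have abK: "a\<^sub>1 \<in> constructibles E" "a\<^sub>2 \<in> constructibles E" "b\<^sub>0 \<in> constructibles E" "b\<^sub>1 \<in> constructibles E"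
    "b\<^sub>2 \<in> constructibles E"
    unfolding a\<^sub>1_def a\<^sub>2_def b\<^sub>0_def b\<^sub>1_def b\<^sub>2_def by (intro arithmetic_constructible K eK)+
  have dK: "d \<in> constructibles E"
  proof (rule quartic_root_constructible)
    \<comment> \<open>the coefficients of \<open>G\<close>\<close>
    show "2 * b\<^sub>0 * (f 7)\<^sup>2 \<in> constructibles E"
      "- 8 * b\<^sub>0 * f 7 * f 6 + 2 * a\<^sub>1\<^sup>2 * f 7 \<in> constructibles E"
      "2 * b\<^sub>0 * (4 * (f 6)\<^sup>2 + 4 * a\<^sub>2 * f 7) - a\<^sub>1 * (6 * f 7 * b\<^sub>1 + 2 * a\<^sub>1 * f 6) \<in> constructibles E"
      "- 16 * b\<^sub>0 * a\<^sub>2 * f 6 + a\<^sub>1 * (4 * b\<^sub>1 * f 6 + 2 * a\<^sub>1 * a\<^sub>2) + 4 * f 7 * b\<^sub>1\<^sup>2 \<in> constructibles E"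
      "8 * b\<^sub>0 * a\<^sub>2\<^sup>2 - 4 * a\<^sub>1 * a\<^sub>2 * b\<^sub>1 \<in> constructibles E"
      by (intro arithmetic_constructible K abK)+
    show "2 * b\<^sub>0 * (f 7)\<^sup>2 \<noteq> 0" using signs by simp
    show "2 * b\<^sub>0 * (f 7)\<^sup>2 * d ^ 4 + (- 8 * b\<^sub>0 * f 7 * f 6 + 2 * a\<^sub>1\<^sup>2 * f 7) * d ^ 3
      + (2 * b\<^sub>0 * (4 * (f 6)\<^sup>2 + 4 * a\<^sub>2 * f 7) - a\<^sub>1 * (6 * f 7 * b\<^sub>1 + 2 * a\<^sub>1 * f 6)) * d\<^sup>2
      + (- 16 * b\<^sub>0 * a\<^sub>2 * f 6 + a\<^sub>1 * (4 * b\<^sub>1 * f 6 + 2 * a\<^sub>1 * a\<^sub>2) + 4 * f 7 * b\<^sub>1\<^sup>2) * d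
      + (8 * b\<^sub>0 * a\<^sub>2\<^sup>2 - 4 * a\<^sub>1 * a\<^sub>2 * b\<^sub>1) = 0"
      using Gd unfolding G_def h_def k_def by algebra
  qed
  have \<rho>K: "\<rho> \<in> constructibles E"
    unfolding \<rho>_def h_def k_def by (intro arithmetic_constructible K abK dK)
  have \<kappa>K: "\<kappa> \<in> constructibles E"
    unfolding \<kappa>_def by (intro arithmetic_constructible abK dK \<rho>K)

  have f1: "f 1 = e * f 3 - e\<^sup>2 * f 5 + e ^ 3 * f 7" using e by simp
  have F: "(x\<^sup>2 + e) ^ 3 * (f 7 * x + f 6) + (x\<^sup>2 + e)\<^sup>2 * (a\<^sub>2 * x + b\<^sub>2) + (x\<^sup>2 + e) * (a\<^sub>1 * x + b\<^sub>1) + b\<^sub>0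
      = (\<Sum>i=0..7. f i * x ^ i)" for x
  proof -
    have "(\<Sum>i=0..7. f i * x ^ i) = f 0 + f 1 * x + f 2 * x ^ 2 + f 3 * x ^ 3 + f 4 * x ^ 4 + f 5 * x ^ 5
        + f 6 * x ^ 6 + f 7 * x ^ 7"
      by (simp add: numeral_eq_Suc)
    then show ?thesis
      unfolding f1 a\<^sub>1_def a\<^sub>2_def b\<^sub>0_def b\<^sub>1_def b\<^sub>2_def by algebra
  qed
  have "finite {x. (\<Sum>i\<le>7. f i * x ^ i) = 0}"
    using signs by (intro polyfun_finite_roots[THEN iffD2]) auto
  then have fin: "finite {x. (\<Sum>i=0..7. f i * x ^ i) = 0}" by (simp add: atMost_atLeast0)
  show ?thesis
    by (rule septic_root_constructible_of_parameters[where a\<^sub>2 = a\<^sub>2 and a\<^sub>3 = "f 7" and b\<^sub>2 = b\<^sub>2 and b\<^sub>3 = "f 6"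
        and d = d and e = e and \<rho> = \<rho> and \<kappa> = \<kappa>, folded h_def, folded a1 b1 b0, unfolded F])
       (fact abK K dK eK \<rho>K \<kappa>K fin t | use signs d0 \<rho> in simp)+
qed

end

section \<open>Moving an arbitrary septic close to a seventh power\<close>

text \<open>The failures with \<open>\<epsilon> \<in> {0..1}\<close> form a compact set, so their projection to \<open>\<epsilon>\<close> is closed and stays
  away from zero. This allows the sign conditions to be checked for all \<open>e\<close> in an interval at once, at the limit
  \<open>\<epsilon> = 0\<close> only.\<close>

lemma eventually_pos_on_compact:
  fixes \<psi> :: "real \<Rightarrow> real \<Rightarrow> real"
  assumes S: "compact S" and cont: "continuous_on UNIV (\<lambda>(\<epsilon>, x). \<psi> \<epsilon> x)"
    and pos: "\<And>x. x \<in> S \<Longrightarrow> 0 < \<psi> 0 x"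
  shows "eventually (\<lambda>\<epsilon>. \<forall>x\<in>S. 0 < \<psi> \<epsilon> x) (at_right 0)"
proof -
  let ?T = "({0..1} \<times> S) \<inter> {p. (\<lambda>(\<epsilon>, x). \<psi> \<epsilon> x) p \<le> 0}"
  have "closed {p. (\<lambda>(\<epsilon>, x). \<psi> \<epsilon> x) p \<le> 0}"
    by (rule closed_Collect_le[OF cont continuous_on_const])
  then have "compact ?T" by (intro compact_Int_closed compact_Times S compact_Icc)
  then have "closed (fst ` ?T)"
    by (intro compact_imp_closed compact_continuous_image continuous_on_fst continuous_on_id)
  moreover have "0 \<notin> fst ` ?T" using pos by (force simp: not_le)
  ultimately have "eventually (\<lambda>\<epsilon>. \<epsilon> \<in> - fst ` ?T) (nhds 0)"
    by (intro eventually_nhds_in_open) auto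
  then have "eventually (\<lambda>\<epsilon>. \<epsilon> \<notin> fst ` ?T) (at_right 0)"
    by (auto simp: eventually_at_filter elim: eventually_mono)
  moreover have "eventually (\<lambda>\<epsilon>::real. 0 < \<epsilon> \<and> \<epsilon> < 1) (at_right 0)"
    by (auto simp: eventually_at_right_field intro: exI[of _ 1])
  ultimately show ?thesis
  proof eventually_elim
    case (elim \<epsilon>)
    show ?case
    proof (rule ballI, rule ccontr)
      fix x assume "x \<in> S" "\<not> 0 < \<psi> \<epsilon> x"
      with elim(2) have "(\<epsilon>, x) \<in> ?T" by simp
      then have "\<epsilon> \<in> fst ` ?T" by force
      with elim(1) show False ..
    qed
  qed
qed

text \<open>The coefficients of the septic in \<open>t\<close> that arises by substituting \<open>W = (1 + t) / \<epsilon>\<close> and dividing by the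
  leading coefficient. The formula makes sense for \<open>\<epsilon> = 0\<close>, where the septic becomes \<open>(1 + t) ^ 7\<close>.\<close>

definition shifted_coeff :: "(nat \<Rightarrow> real) \<Rightarrow> real \<Rightarrow> nat \<Rightarrow> real" where
  "shifted_coeff c \<epsilon> j = (\<Sum>i=0..7. c i / c 7 * \<epsilon> ^ (7 - i) * of_nat (i choose j))"

lemma shifted_coeff_eval:
  assumes "\<epsilon> \<noteq> 0"
  shows "(\<Sum>j=0..7. shifted_coeff c \<epsilon> j * (\<epsilon> * W - 1) ^ j) = \<epsilon> ^ 7 / c 7 * (\<Sum>i=0..7. c i * W ^ i)"
proof -
  let ?t = "\<epsilon> * W - 1"
  have bin: "(\<Sum>j=0..7. of_nat (i choose j) * ?t ^ j) = (\<epsilon> * W) ^ i" if "i \<le> 7" for i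
  proof -
    have "(\<epsilon> * W) ^ i = (?t + 1) ^ i" by simp
    also have "\<dots> = (\<Sum>j\<le>i. of_nat (i choose j) * ?t ^ j)" by (subst binomial_ring) simp
    also have "\<dots> = (\<Sum>j=0..7. of_nat (i choose j) * ?t ^ j)"
      using that by (intro sum.mono_neutral_left) auto
    finally show ?thesis ..
  qed
  have "(\<Sum>j=0..7. shifted_coeff c \<epsilon> j * ?t ^ j)
      = (\<Sum>i=0..7. \<Sum>j=0..7. c i / c 7 * \<epsilon> ^ (7 - i) * (of_nat (i choose j) * ?t ^ j))"
    unfolding shifted_coeff_def sum_distrib_right by (subst sum.swap) (simp add: mult.assoc)
  also have "\<dots> = (\<Sum>i=0..7. c i / c 7 * \<epsilon> ^ (7 - i) * (\<epsilon> * W) ^ i)"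
    by (rule sum.cong) (simp_all only: sum_distrib_left[symmetric] bin atLeastAtMost_iff)
  also have "\<dots> = (\<Sum>i=0..7. \<epsilon> ^ 7 / c 7 * (c i * W ^ i))"
  proof (rule sum.cong)
    fix i :: nat assume "i \<in> {0..7}"
    then have "\<epsilon> ^ (7 - i) * \<epsilon> ^ i = \<epsilon> ^ 7" by (simp flip: power_add)
    then have "c i / c 7 * (\<epsilon> ^ (7 - i) * \<epsilon> ^ i) * W ^ i = c i / c 7 * \<epsilon> ^ 7 * W ^ i" by simp
    then show "c i / c 7 * \<epsilon> ^ (7 - i) * (\<epsilon> * W) ^ i = \<epsilon> ^ 7 / c 7 * (c i * W ^ i)"
      by (simp add: power_mult_distrib mult_ac)
  qed simp
  finally show ?thesis by (simp add: sum_distrib_left)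
qed

lemma shifted_coeff_0:
  assumes "c 7 \<noteq> 0"
  shows "shifted_coeff c 0 j = of_nat (7 choose j)"
proof -
  have "shifted_coeff c 0 j = (\<Sum>i\<in>{7}. c i / c 7 * 0 ^ (7 - i) * of_nat (i choose j))"
    unfolding shifted_coeff_def by (rule sum.mono_neutral_right) (auto simp: power_0_left)
  then show ?thesis using assms by simp
qed

lemma binomial_7:
  "7 choose 0 = 1" "7 choose Suc 0 = 7" "7 choose 2 = 21" "7 choose 3 = 35" "7 choose 4 = 35" "7 choose 5 = 21"
  "7 choose 6 = 7" "7 choose 7 = 1"
  by (simp_all add: numeral_eq_Suc)

text \<open>For \<open>(1 + t) ^ 7\<close> the equation for \<open>e\<close> says that \<open>(1 + \<i> * sqrt e) ^ 7\<close> is real, so that its roots are the squares of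
  \<open>tan (m * pi / 7)\<close> for \<open>m = 1, 2, 3\<close>. The largest of them lies between 19 and 20, and on this whole interval the
  sign conditions hold with a wide margin; they persist for small \<open>\<epsilon>\<close>, and a rational \<open>\<epsilon>\<close> is
  constructible.\<close>

theorem septic_root_constructible:
  fixes c :: "nat \<Rightarrow> real" and W :: real
  assumes K: "\<And>i. i \<le> 7 \<Longrightarrow> c i \<in> constructibles E" and c7: "c 7 \<noteq> 0"
    and W: "(\<Sum>i=0..7. c i * W ^ i) = 0"
  shows "W \<in> constructibles E"
proof -
  define f where "f = shifted_coeff c"
  note f0 = shifted_coeff_0[of c, OF c7, folded f_def]
  define a\<^sub>1 where "a\<^sub>1 \<epsilon> e = f \<epsilon> 3 - 2 * e * f \<epsilon> 5 + 3 * e\<^sup>2 * f \<epsilon> 7" for \<epsilon> e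
  define a\<^sub>2 where "a\<^sub>2 \<epsilon> e = f \<epsilon> 5 - 3 * e * f \<epsilon> 7" for \<epsilon> e
  define b\<^sub>0 where "b\<^sub>0 \<epsilon> e = f \<epsilon> 0 - e * f \<epsilon> 2 + e\<^sup>2 * f \<epsilon> 4 - e ^ 3 * f \<epsilon> 6" for \<epsilon> e
  define b\<^sub>1 where "b\<^sub>1 \<epsilon> e = f \<epsilon> 2 - 2 * e * f \<epsilon> 4 + 3 * e\<^sup>2 * f \<epsilon> 6" for \<epsilon> e
  define r where "r \<epsilon> e = a\<^sub>2 \<epsilon> e * (a\<^sub>1 \<epsilon> e)\<^sup>2 - 2 * f \<epsilon> 6 * b\<^sub>1 \<epsilon> e * a\<^sub>1 \<epsilon> e + 2 * (b\<^sub>1 \<epsilon> e)\<^sup>2 * f \<epsilon> 7" for \<epsilon> e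
  define p where "p \<epsilon> e = f \<epsilon> 1 - e * f \<epsilon> 3 + e\<^sup>2 * f \<epsilon> 5 - e ^ 3 * f \<epsilon> 7" for \<epsilon> e
  note defs = a\<^sub>1_def a\<^sub>2_def b\<^sub>0_def b\<^sub>1_def r_def p_def
  have cont_f: "continuous_on S (\<lambda>x. f (g x) j)" if "continuous_on S g" for S and g :: "real \<times> real \<Rightarrow> real" and j
    unfolding f_def shifted_coeff_def by (intro continuous_intros that)
  let ?ev = "\<lambda>\<psi>. eventually (\<lambda>\<epsilon>. \<forall>e\<in>{19..20}. 0 < \<psi> \<epsilon> e) (at_right (0::real))"
  have ev: "?ev \<psi>" if "\<And>e. 19 \<le> e \<Longrightarrow> e \<le> 20 \<Longrightarrow> 0 < \<psi> 0 e" "continuous_on UNIV (\<lambda>(\<epsilon>, e). \<psi> \<epsilon> e)"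
    for \<psi> :: "real \<Rightarrow> real \<Rightarrow> real"
    using that by (intro eventually_pos_on_compact) auto
  have lim: "0 < - a\<^sub>2 0 e" "0 < a\<^sub>1 0 e" "0 < b\<^sub>1 0 e" "0 < - b\<^sub>0 0 e" "0 < r 0 e" if e: "19 \<le> e" "e \<le> 20" for e
  proof -
    have a1: "a\<^sub>1 0 e = 35 + 3 * (e * (e - 14))" and a2: "a\<^sub>2 0 e = 21 - 3 * e"
      and b1: "b\<^sub>1 0 e = 21 + 7 * (e * (3 * e - 10))"
      and b0: "- b\<^sub>0 0 e = 21 * e - 1 + 7 * (e\<^sup>2 * (e - 5))"
      by (simp_all add: defs f0 binomial_7 power2_eq_square power3_eq_cube algebra_simps)
    show "0 < - a\<^sub>2 0 e" using e by (simp add: a2)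
    have "19 * 5 \<le> e * (e - 14)" "e * (e - 14) \<le> 20 * 6" using e by (intro mult_mono; simp)+
    then have A: "320 \<le> a\<^sub>1 0 e" "a\<^sub>1 0 e \<le> 395" unfolding a1 by simp_all
    then show "0 < a\<^sub>1 0 e" by simp
    have "19 * 47 \<le> e * (3 * e - 10)" using e by (intro mult_mono) simp_all
    then have B: "6272 \<le> b\<^sub>1 0 e" unfolding b1 by simp
    then show "0 < b\<^sub>1 0 e" by simp
    show "0 < - b\<^sub>0 0 e"
      unfolding b0 using e by (intro add_pos_nonneg mult_nonneg_nonneg) simp_all
    have d: "b\<^sub>1 0 e - 7 * a\<^sub>1 0 e = 224 * (e - 1)" unfolding a1 b1 by (simp add: algebra_simps)
    have "r 0 e = 2 * (b\<^sub>1 0 e * (b\<^sub>1 0 e - 7 * a\<^sub>1 0 e)) - (3 * e - 21) * (a\<^sub>1 0 e)\<^sup>2"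
      by (simp add: r_def f0 binomial_7 a2 power2_eq_square algebra_simps)
    moreover have "6272 * (224 * 18) \<le> b\<^sub>1 0 e * (b\<^sub>1 0 e - 7 * a\<^sub>1 0 e)"
      unfolding d using e B by (intro mult_mono) simp_all
    moreover have "(3 * e - 21) * (a\<^sub>1 0 e)\<^sup>2 \<le> 39 * 395\<^sup>2"
      using e A by (intro mult_mono power_mono) simp_all
    ultimately show "0 < r 0 e" by simp
  qed
  have "?ev (\<lambda>\<epsilon> e. - a\<^sub>2 \<epsilon> e)" "?ev a\<^sub>1" "?ev b\<^sub>1" "?ev (\<lambda>\<epsilon> e. - b\<^sub>0 \<epsilon> e)" "?ev r"
    "?ev (\<lambda>\<epsilon> (e::real). f \<epsilon> 7)" "?ev (\<lambda>\<epsilon> (e::real). p \<epsilon> 19)" "?ev (\<lambda>\<epsilon> (e::real). - p \<epsilon> 20)"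
    by (-, (rule ev, use lim in \<open>simp add: p_def f0 binomial_7\<close>,
        simp only: defs case_prod_unfold, intro continuous_intros cont_f)+)
  moreover have "eventually (\<lambda>\<epsilon>::real. 0 < \<epsilon>) (at_right 0)" by (simp add: eventually_at_right_less)
  ultimately have "eventually (\<lambda>\<epsilon>. 0 < \<epsilon> \<and> 0 < f \<epsilon> 7 \<and> 0 < p \<epsilon> 19 \<and> p \<epsilon> 20 < 0 \<and>
      (\<forall>e\<in>{19..20}. a\<^sub>2 \<epsilon> e < 0 \<and> 0 < a\<^sub>1 \<epsilon> e \<and> 0 < b\<^sub>1 \<epsilon> e \<and> b\<^sub>0 \<epsilon> e < 0 \<and> 0 < r \<epsilon> e)) (at_right 0)"
    by eventually_elim auto
  then obtain \<epsilon>\<^sub>0 where "\<epsilon>\<^sub>0 > 0" and \<epsilon>\<^sub>0: "\<And>\<epsilon>. 0 < \<epsilon> \<Longrightarrow> \<epsilon> < \<epsilon>\<^sub>0 \<Longrightarrow> 0 < \<epsilon> \<and> 0 < f \<epsilon> 7 \<and> 0 < p \<epsilon> 19 \<and> p \<epsilon> 20 < 0 \<and>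
      (\<forall>e\<in>{19..20}. a\<^sub>2 \<epsilon> e < 0 \<and> 0 < a\<^sub>1 \<epsilon> e \<and> 0 < b\<^sub>1 \<epsilon> e \<and> b\<^sub>0 \<epsilon> e < 0 \<and> 0 < r \<epsilon> e)"
    unfolding eventually_at_right_field by blast
  obtain \<epsilon> where \<epsilon>: "\<epsilon> \<in> \<rat>" "0 < \<epsilon>" "\<epsilon> < \<epsilon>\<^sub>0" using Rats_dense_in_real[OF \<open>\<epsilon>\<^sub>0 > 0\<close>] by blast
  note pos = \<epsilon>\<^sub>0[OF \<epsilon>(2,3)]
  have "continuous_on {19..20} (p \<epsilon>)" unfolding p_def by (intro continuous_intros)
  then obtain e where e: "19 \<le> e" "e \<le> 20" "p \<epsilon> e = 0"
    using IVT2'[of "p \<epsilon>" 20 0 19] pos by force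
  have \<epsilon>K: "\<epsilon> \<in> constructibles E" using \<epsilon>(1) Rats_constructible by blast
  have fK: "f \<epsilon> j \<in> constructibles E" for j
    unfolding f_def shifted_coeff_def
    by (intro sum_constructible mult_constructible divide_constructible power_constructible
        of_nat_constructible K \<epsilon>K) simp_all
  have root: "(\<Sum>j=0..7. f \<epsilon> j * (\<epsilon> * W - 1) ^ j) = 0"
    using \<epsilon>(2) by (simp add: f_def shifted_coeff_eval W)
  have "0 < e" "0 < f \<epsilon> 7" "a\<^sub>2 \<epsilon> e < 0" "0 < a\<^sub>1 \<epsilon> e" "0 < b\<^sub>1 \<epsilon> e" "b\<^sub>0 \<epsilon> e < 0" "0 < r \<epsilon> e"
    using pos e(1,2) by auto
  note signs = this[unfolded r_def, unfolded a\<^sub>1_def a\<^sub>2_def b\<^sub>0_def b\<^sub>1_def]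
  have t: "\<epsilon> * W - 1 \<in> constructibles E"
    by (rule septic_root_constructible_of_signs[OF fK e(3)[unfolded p_def] signs root])
  have "(\<epsilon> * W - 1 + 1) / \<epsilon> \<in> constructibles E"
    by (rule divide_constructible[OF add_constructible[OF t one_constructible] \<epsilon>K])
  then show ?thesis using \<epsilon>(2) by simp
qed

theorem theorem4:
  "\<exists>D :: rat_mpoly. D \<noteq> 0 \<and> mpoly_vars D \<subseteq> {0..7} \<and>
     (\<forall>c :: nat \<Rightarrow> real. c 7 \<noteq> 0 \<longrightarrow> mpoly_eval D c \<noteq> 0 \<longrightarrow>
       (\<forall>W :: real. (\<Sum>i=0..7. c i * W ^ i) = 0 \<longrightarrow>
          two_fold_constructible (c ` {0..7}) W \<and>
          ((\<forall>i\<in>{0..7}. c i \<in> \<rat>) \<longrightarrow> two_fold_constructible {} W)))"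
proof (intro exI[of _ 1] conjI allI impI)
  show "(1 :: rat_mpoly) \<noteq> 0" by simp
  show "mpoly_vars 1 \<subseteq> {0..7}" by (simp add: mpoly_vars_def)
next
  fix c :: "nat \<Rightarrow> real" and W :: real
  assume c7: "c 7 \<noteq> 0" and W: "(\<Sum>i=0..7. c i * W ^ i) = 0"
  have "c i \<in> constructibles (c ` {0..7})" if "i \<le> 7" for i
    using that by (auto simp: constructibles_iff intro: datum)
  from septic_root_constructible[OF this c7 W] show "two_fold_constructible (c ` {0..7}) W"
    by (simp add: constructibles_def)
  assume "\<forall>i\<in>{0..7}. c i \<in> \<rat>"
  then have "c i \<in> constructibles {}" if "i \<le> 7" for i
    using that Rats_constructible[of "{}"] by auto
  from septic_root_constructible[OF this c7 W] show "two_fold_constructible {} W"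
    by (simp add: constructibles_def)
qed

end
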